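(* Let $k\ge 2$ be fixed, and assume the Minimal Cycle Conjecture (as stated in the context). Let $s_1,\dots,s_k$ be chosen independently and uniformly at random from $S_n$, and let $G$ denote the group they generate. Then almost always (i.e. with probability tending to $1$ as $n\to\infty$), $G\in\{S_n,A_n\}$ and, for $s\in G$, the length of the expression for $s$, as a product of elements of $\{s_1,\dots,s_k\}^{\pm 1}$, obtained by the generic membership search algorithm (described in the context) is $O(n^2\log n)$.
   Context: Notation: $S_n$ is the symmetric group on $\{1,\dots,n\}$ and $A_n$ the alternating group. For $S=\{s_1,\dots,s_k\}$, $S^{\pm1}=\{s_1,\dots,s_k,s_1^{-1},\dots,s_k^{-1}\}$. "Almost always" means with probability approaching $1$ as $n\to\infty$. The length of an expression is the number of letters from $S^{\pm1}$ in it, written out in full with no compression of powers. Minimal Cycle Conjecture: Let $S$ be a set of $k$ elements of $S_n$, each chosen independently according to the uniform distribution on $S_n$. Let $c=3$ if all elements of $S$ are even, and $c=2$ otherwise. Consider the list consisting of the elements of $S^{\pm1}$, followed by all products of two elements of $S^{\pm1}$, followed by all products of three elements of $S^{\pm1}$, etc. Then, almost always, there is among the first $n^2$ elements of the list an element $\tau$ such that $\tau^m$ is a $c$-cycle for some $m\le n$. Generic membership search algorithm. Input: $G=S_n$ or $A_n$; generators $s_1,\dots,s_k$ of $G$; $s\in G$. During the execution, the expressions of the computed permutations in terms of $S^{\pm1}$ are kept. Initialization: $c=2$ if $G=S_n$ and $c=3$ if $G=A_n$. $C$ is the set of $c$-cycles in a canonical expression of $s$ as a product of at most $n/(c-1)$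 $c$-cycles. Step 1: Consider the elements $\tau\in\langle s_1,\dots,s_k\rangle$ one at a time, in breadth-first order (first the elements of $S^{\pm1}$, then the free-reduced products of two elements of $S^{\pm 1}$, etc.), until there is $m\in\{1,\dots,n\}$ such that $\tau^m$ is a $c$-cycle; set $\mu=\tau^m$ and stop. Step 2: Set $A_0=\{\mu\}$. For $l=1,2,\dots$: start with $A_l=\emptyset$; for each $i\in\{1,\dots,k\}$, each $\epsilon\in\{-1,1\}$ and each $a\in A_{l-1}$, if $s_i^{-\epsilon}as_i^{\epsilon}\notin A_0\cup\dots\cup A_l$, add $s_i^{-\epsilon}as_i^{\epsilon}$ to $A_l$; as soon as $C\subseteq A_0\cup\dots\cup A_l$, stop. Final step: Substitute the expressions obtained for the $c$-cycles in $C$ into the canonical expression of $s$, to obtain an expression of $s$ in terms of $S^{\pm1}$. *)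

theory Defs
  imports
    "HOL-Algebra.Sym_Groups"
    "HOL-Algebra.Generated_Groups"
    "HOL-Probability.Product_PMF"
    "HOL-Library.While_Combinator"
begin

section \<open>Words in the generators and their inverses\<close>

text \<open>
  The pair \<open>(i, True)\<close> stands for \<open>s\<^sub>i\<close> and \<open>(i, False)\<close> for its inverse. An expression is a list
  of letters, so its length is the length with all powers written out. Words are formal: a
  coincidence such as \<open>s\<^sub>1 = s\<^sub>2\<close> does not identify letters.
\<close>

type_synonym perm = "nat \<Rightarrow> nat"
type_synonym letter = "nat \<times> bool"
type_synonym word = "letter list"

definition letters :: "nat \<Rightarrow> letter set" where
  "letters k = {1..k} \<times> UNIV"

fun inv_letter :: "letter \<Rightarrow> letter" where
  "inv_letter (i, b) = (i, \<not> b)"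

fun letter_perm :: "(nat \<Rightarrow> perm) \<Rightarrow> letter \<Rightarrow> perm" where
  "letter_perm s (i, b) = (if b then s i else inv' (s i))"

definition word_perm :: "(nat \<Rightarrow> perm) \<Rightarrow> word \<Rightarrow> perm" where
  "word_perm s w = foldr (\<lambda>x p. letter_perm s x \<circ> p) w id"

definition words :: "nat \<Rightarrow> word set" where
  "words k = {w. w \<noteq> [] \<and> set w \<subseteq> letters k}"

definition reduced_words :: "nat \<Rightarrow> word set" where
  "reduced_words k =
     {w \<in> words k. \<forall>j. Suc j < length w \<longrightarrow> w ! Suc j \<noteq> inv_letter (w ! j)}"

text \<open>The order among words of the same length is left open.\<close>

definition breadth_first :: "word set \<Rightarrow> (nat \<Rightarrow> word) \<Rightarrow> bool" where
  "breadth_first W e \<longleftrightarrow> bij_betw e UNIV W \<and> mono (\<lambda>j. length (e j))"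


section \<open>Random generators and the Minimal Cycle Conjecture\<close>

definition c_cycles :: "nat \<Rightarrow> nat \<Rightarrow> perm set" where
  "c_cycles n c = {cycle_of_list xs | xs. cycle xs \<and> length xs = c \<and> set xs \<subseteq> {1..n}}"

text \<open>Outside \<open>{1..k}\<close> the family of generators takes the irrelevant default value \<open>id\<close>.\<close>

definition random_generators :: "nat \<Rightarrow> nat \<Rightarrow> (nat \<Rightarrow> perm) pmf" where
  "random_generators k n = Pi_pmf {1..k} id (\<lambda>_. pmf_of_set (carrier (sym_group n)))"

definition almost_always :: "nat \<Rightarrow> (nat \<Rightarrow> (nat \<Rightarrow> perm) \<Rightarrow> bool) \<Rightarrow> bool" where
  "almost_always k P \<longleftrightarrow>
     (\<lambda>n. measure_pmf.prob (random_generators k n) {s. P n s}) \<longlonglongrightarrow> 1"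

text \<open>
  The listing \<open>e\<close> runs through all (not only the reduced) words, so a permutation is listed once
  for every word representing it. The conjecture is stated for a single number \<open>k\<close> of generators
  because it fails for \<open>k = 1\<close>.
\<close>

definition minimal_cycle_conjecture :: "nat \<Rightarrow> (nat \<Rightarrow> word) \<Rightarrow> bool" where
  "minimal_cycle_conjecture k e \<longleftrightarrow>
     almost_always k (\<lambda>n s.
       let c = (if \<forall>i\<in>{1..k}. evenperm (s i) then 3 else 2)
       in \<exists>j < n\<^sup>2. \<exists>m \<le> n. word_perm s (e j) ^^ m \<in> c_cycles n c)"


section \<open>The generic membership search algorithm\<close>

definition generated :: "nat \<Rightarrow> nat \<Rightarrow> (nat \<Rightarrow> perm) \<Rightarrow> perm set" where
  "generated n k s = generate (sym_group n) (s ` {1..k})"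

text \<open>The input group is assumed to be the symmetric or the alternating group.\<close>

definition cycle_length :: "nat \<Rightarrow> nat \<Rightarrow> (nat \<Rightarrow> perm) \<Rightarrow> nat" where
  "cycle_length n k s = (if generated n k s = carrier (sym_group n) then 2 else 3)"

definition canonical_expression :: "nat \<Rightarrow> nat \<Rightarrow> perm \<Rightarrow> perm list \<Rightarrow> bool" where
  "canonical_expression n c \<sigma> cs \<longleftrightarrow>
     set cs \<subseteq> c_cycles n c \<and> foldr (\<circ>) cs id = \<sigma> \<and> real (length cs) \<le> real n / (real c - 1)"

text \<open>
  Step 1 returns the expression of \<open>\<mu> = \<tau>\<^sup>m\<close>, or \<open>None\<close> if the search does not end. Which exponent
  is taken, if several are possible, is left open.
\<close>

definition step1 :: "nat \<Rightarrow> nat \<Rightarrow> (nat \<Rightarrow> perm) \<Rightarrow> (nat \<Rightarrow> word) \<Rightarrow> word option" where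
  "step1 n c s e =
     (let good = (\<lambda>j m. m \<in> {1..n} \<and> word_perm s (e j) ^^ m \<in> c_cycles n c)
      in if \<exists>j m. good j m
         then let j = (LEAST j. \<exists>m. good j m); m = (SOME m. good j m)
              in Some (concat (replicate m (e j)))
         else None)"

text \<open>
  In a state \<open>(T, A, Q)\<close> of Step 2, the domain of \<open>T\<close> is \<open>A\<^sub>0 \<union> \<dots> \<union> A\<^sub>l\<close>, and \<open>T\<close> maps each of its
  elements to the expression found for it; \<open>A\<close> is the current level \<open>A\<^sub>l\<close>; and \<open>Q\<close> contains the pairs
  \<open>(x, a)\<close>, with \<open>x\<close> a letter and \<open>a \<in> A\<^bsub>l-1\<^esub>\<close>, that remain to be considered for this level. When
  \<open>Q\<close> is exhausted, the next level is started. The function \<open>trav\<close> determines the order in which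
  the pairs are considered.
\<close>

type_synonym state = "(perm \<rightharpoonup> word) \<times> perm set \<times> (letter \<times> perm) list"

definition traversal :: "nat \<Rightarrow> (perm set \<Rightarrow> (letter \<times> perm) list) \<Rightarrow> bool" where
  "traversal k trav \<longleftrightarrow>
     (\<forall>A. finite A \<longrightarrow> distinct (trav A) \<and> set (trav A) = letters k \<times> A)"

fun step2_body ::
  "(nat \<Rightarrow> perm) \<Rightarrow> (perm set \<Rightarrow> (letter \<times> perm) list) \<Rightarrow> state \<Rightarrow> state" where
  "step2_body s trav (T, A, []) = (T, {}, trav A)"
| "step2_body s trav (T, A, (x, a) # Q) =
     (let b = letter_perm s (inv_letter x) \<circ> a \<circ> letter_perm s x
      in if b \<in> dom T then (T, A, Q)
         else (T(b \<mapsto> [inv_letter x] @ the (T a) @ [x]), insert b A, Q))"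

text \<open>The value is \<open>None\<close> if the loop does not terminate.\<close>

definition step2 ::
  "(nat \<Rightarrow> perm) \<Rightarrow> (perm set \<Rightarrow> (letter \<times> perm) list) \<Rightarrow> perm set \<Rightarrow> word
    \<Rightarrow> (perm \<rightharpoonup> word) option" where
  "step2 s trav C w =
     (let \<mu> = word_perm s w
      in map_option fst
           (while_option (\<lambda>(T, A, Q). \<not> C \<subseteq> dom T) (step2_body s trav) ([\<mu> \<mapsto> w], {\<mu>}, [])))"

text \<open>
  The element \<open>s \<in> G\<close> that is to be expressed enters through its canonical expression \<open>cs\<close>.
\<close>

definition membership_search ::
  "nat \<Rightarrow> nat \<Rightarrow> (nat \<Rightarrow> perm) \<Rightarrow> (nat \<Rightarrow> word) \<Rightarrow> (perm set \<Rightarrow> (letter \<times> perm) list)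
    \<Rightarrow> perm list \<Rightarrow> word option" where
  "membership_search n k s e trav cs =
     (case step1 n (cycle_length n k s) s e of
        None \<Rightarrow> None
      | Some w \<Rightarrow>
          (case step2 s trav (set cs) w of
             None \<Rightarrow> None
           | Some T \<Rightarrow> Some (concat (map (\<lambda>a. the (T a)) cs))))"

end

theory Submission
  imports Defs
begin

text \<open>
  The output is a concatenation of at most \<open>n\<close> expressions of \<open>c\<close>-cycles. Step 1 contributes the
  expression of a first \<open>c\<close>-cycle \<open>\<mu>\<close>: a conjectured word of rank below \<open>n\<^sup>2\<close> in the list has length
  \<open>O(log n)\<close>, because there are at least \<open>4\<^sup>l\<close> words of length \<open>l\<close>, so that a power of it with
  exponent at most \<open>n\<close> has length \<open>O(n log n)\<close>. Step 2 adds twice the length of a shortest word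
  that conjugates \<open>\<mu>\<close> to the wanted cycle. Hence it suffices that such conjugating words of length
  \<open>O(n log n)\<close> exist, and for this two properties of the pair \<open>s\<^sub>1, s\<^sub>2\<close> are enough, each failing
  with probability \<open>O(1/n)\<close> by a union bound: the action on points is an expander
  (\<open>prob_not_expanding\<close>), and no partition of the points into equally large blocks is invariant
  under both permutations (\<open>prob_preserves_uniform_partition\<close>).
  
  Expansion makes the balls around any two points meet after \<open>O(log n)\<close> steps, so any point is
  carried to any other by a word of that length (\<open>point_distance\<close>). In particular the group is
  transitive. Being joined by a \<open>c\<close>-cycle of the group is an invariant equivalence relation on the
  points. Its classes form an invariant partition into blocks of one size greater than \<open>1\<close>, hence
  there is just one class, and the group is the symmetric or the alternating group, according to
  the parity of the generators (\<open>generated_eq_by_parity\<close>).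
  
  Distances between pairs of points then need no further randomness. Fix a base point; its
  stabilizer is generated by elements of length \<open>O(log n)\<close>, namely generators corrected at both
  ends by short words that move the base point. A walk from one point to another need not
  visit any point twice, so the stabilizer moves any second point to any other by a word of length \<open>O(n log n)\<close>
  (\<open>pair_distance\<close>). This settles transpositions.
  
  For 3-cycles, repeating this argument with triples would cost \<open>O(n\<^sup>2 log n)\<close>. Instead, the 3-cycle
  \<open>\<mu>\<close>, whose word has length \<open>O(n log n)\<close>, is used once more: conjugating it by words for pairs
  gives for any \<open>x \<noteq> y\<close> some 3-cycle \<open>(x y z)\<close> of length \<open>O(n log n)\<close>, where \<open>z\<close> is not under
  control. A product of at most four of these and their inverses suffices to move a third point
  to any other while fixing two given points (\<open>move_point_fixing_two_points\<close>). The same lemma,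
  applied without regard to lengths, produces all 3-cycles in the group from one.
\<close>

section \<open>Uniform random permutations acting on finite sets\<close>

abbreviation uniform_perm :: "nat \<Rightarrow> perm pmf" where
  "uniform_perm n \<equiv> pmf_of_set (carrier (sym_group n))"

lemma carrier_sym_group: "carrier (sym_group n) = {p. p permutes {1..n}}"
  by (simp add: sym_group_def)

lemma carrier_alt_group: "carrier (alt_group n) = {p. p permutes {1..n} \<and> evenperm p}"
  by (simp add: alt_group_def)

lemma finite_carrier_sym_group: "finite (carrier (sym_group n))"
  by (simp add: carrier_sym_group finite_permutations)

lemma carrier_sym_group_nonempty: "carrier (sym_group n) \<noteq> {}"
  unfolding carrier_sym_group using permutes_id[of "{1..n}"] by blast

text \<open>
  All the sets of permutations that carry \<open>x\<close> to a given point of \<open>X\<close> are translates of each other,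
  hence equally large: the image of \<open>x\<close> is uniformly distributed.
\<close>

lemma prob_transitive_action:
  fixes act :: "perm \<Rightarrow> 'x \<Rightarrow> 'x"
  assumes X: "finite X" "x \<in> X" "Y \<subseteq> X"
    and act_id: "\<And>y. act id y = y"
    and act_comp: "\<And>p q y. act (p \<circ> q) y = act p (act q y)"
    and closed: "\<And>p y. p permutes {1..n} \<Longrightarrow> y \<in> X \<Longrightarrow> act p y \<in> X"
    and trans: "\<And>y z. y \<in> X \<Longrightarrow> z \<in> X \<Longrightarrow> \<exists>p. p permutes {1..n} \<and> act p y = z"
  shows "measure_pmf.prob (uniform_perm n) {p. act p x \<in> Y} = card Y / card X"
proof -
  let ?G = "carrier (sym_group n)"
  define F where "F y = {p \<in> ?G. act p x = y}" for y
  have finF: "finite (F y)" for y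
    using finite_carrier_sym_group by (simp add: F_def)
  have cardF: "card (F y) = card (F x)" if y: "y \<in> X" for y
  proof -
    obtain h where h: "h permutes {1..n}" "act h x = y"
      using trans X(2) y by blast
    have iv: "inv' h permutes {1..n}" "inv' h \<circ> h = id" "h \<circ> inv' h = id"
      using h(1) by (auto simp: permutes_inv permutes_inv_o)
    have hy: "act (inv' h) y = x"
      using h(2) iv(2) act_comp[of "inv' h" h x] act_id by simp
    have "bij_betw (\<lambda>g. h \<circ> g) (F x) (F y)"
    proof (rule bij_betwI[where g = "\<lambda>g. inv' h \<circ> g"])
      show "(\<lambda>g. h \<circ> g) \<in> F x \<rightarrow> F y"
        using h by (auto simp: F_def carrier_sym_group act_comp permutes_compose)
      show "(\<lambda>g. inv' h \<circ> g) \<in> F y \<rightarrow> F x"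
        using iv hy by (auto simp: F_def carrier_sym_group act_comp permutes_compose)
      show "inv' h \<circ> (h \<circ> g) = g" for g
        using iv by (simp add: o_assoc)
      show "h \<circ> (inv' h \<circ> g) = g" for g
        using iv by (simp add: o_assoc)
    qed
    thus ?thesis by (simp add: bij_betw_same_card)
  qed
  have count: "card {p \<in> ?G. act p x \<in> Z} = card Z * card (F x)" if Z: "Z \<subseteq> X" for Z
  proof -
    have "{p \<in> ?G. act p x \<in> Z} = (\<Union>y\<in>Z. F y)"
      by (auto simp: F_def)
    also have "card \<dots> = (\<Sum>y\<in>Z. card (F y))"
      using Z X(1) finF by (intro card_UN_disjoint) (auto simp: F_def intro: finite_subset)
    also have "\<dots> = (\<Sum>y\<in>Z. card (F x))"
      using Z cardF by (intro sum.cong) auto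
    finally show ?thesis by simp
  qed
  have "{p \<in> ?G. act p x \<in> X} = ?G"
    using closed X(2) by (auto simp: carrier_sym_group)
  hence G: "card ?G = card X * card (F x)"
    using count[of X] by simp
  have "card ?G > 0"
    using finite_carrier_sym_group carrier_sym_group_nonempty by (simp add: card_gt_0_iff)
  hence pos: "card (F x) > 0"
    using G by (cases "card (F x)") auto
  have "measure_pmf.prob (uniform_perm n) {p. act p x \<in> Y} = card (?G \<inter> {p. act p x \<in> Y}) / card ?G"
    by (rule measure_pmf_of_set[OF carrier_sym_group_nonempty finite_carrier_sym_group])
  also have "?G \<inter> {p. act p x \<in> Y} = {p \<in> ?G. act p x \<in> Y}"
    by auto
  finally show ?thesis
    using pos by (simp add: count X(3) G)
qed

lemma prob_first_two_generators:
  assumes "k \<ge> 2"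
  shows "measure_pmf.prob (random_generators k n) {s. s 1 \<in> A \<and> s 2 \<in> B} =
    measure_pmf.prob (uniform_perm n) A * measure_pmf.prob (uniform_perm n) B"
proof -
  define C where "C i = (if i = 1 then A else if i = 2 then B else UNIV)" for i :: nat
  have "{s. s 1 \<in> A \<and> s 2 \<in> B} = Pi {1..k} C" (is "?L = ?R")
  proof (intro subset_antisym subsetI)
    fix s assume "s \<in> Pi {1..k} C"
    moreover have "1 \<in> {1..k}" "2 \<in> {1..k}"
      using assms by auto
    ultimately have "s 1 \<in> C 1" "s 2 \<in> C 2"
      by blast+
    thus "s \<in> ?L"
      by (simp add: C_def)
  qed (auto simp: C_def Pi_def)
  hence "measure_pmf.prob (random_generators k n) {s. s 1 \<in> A \<and> s 2 \<in> B} =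
      (\<Prod>i\<in>{1..k}. measure_pmf.prob (uniform_perm n) (C i))"
    by (simp add: random_generators_def measure_Pi_pmf_Pi)
  also have "\<dots> = (\<Prod>i\<in>{1, 2}. measure_pmf.prob (uniform_perm n) (C i))"
    using assms by (intro prod.mono_neutral_right) (auto simp: C_def)
  finally show ?thesis
    by (simp add: C_def)
qed

lemma random_generators_permute:
  assumes "s \<in> set_pmf (random_generators k n)" "i \<in> {1..k}"
  shows "s i permutes {1..n}"
  using assms finite_carrier_sym_group carrier_sym_group_nonempty
  by (auto simp: random_generators_def set_Pi_pmf PiE_dflt_def carrier_sym_group)

text \<open>
  The squares come from the independence of the first two generators. They are what makes the
  union bounds below effective: an event of probability \<open>1 / N\<close> can be tested on \<open>N\<close> objects \<open>x\<close>.
\<close>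

lemma prob_union_bound:
  assumes "k \<ge> 2" "finite X"
  shows "measure_pmf.prob (random_generators k n) {s. \<exists>x\<in>X. s 1 \<in> A x \<and> s 2 \<in> A x} \<le>
    (\<Sum>x\<in>X. (measure_pmf.prob (uniform_perm n) (A x))\<^sup>2)"
proof -
  have "{s. \<exists>x\<in>X. s 1 \<in> A x \<and> s 2 \<in> A x} = (\<Union>x\<in>X. {s. s 1 \<in> A x \<and> s 2 \<in> A x})"
    by auto
  also have "measure_pmf.prob (random_generators k n) \<dots> \<le>
      (\<Sum>x\<in>X. measure_pmf.prob (random_generators k n) {s. s 1 \<in> A x \<and> s 2 \<in> A x})"
    using assms by (intro measure_pmf.finite_measure_subadditive_finite) auto
  finally show ?thesis
    by (simp only: prob_first_two_generators[OF assms(1)] power2_eq_square)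
qed

lemma permutes_extending_bij_betw:
  fixes n :: nat
  assumes "bij_betw f {1..n} {1..n}"
  shows "\<exists>p. p permutes {1..n} \<and> (\<forall>x\<in>{1..n}. p x = f x)"
proof (intro exI conjI)
  show "(\<lambda>x. if x \<in> {1..n} then f x else x) permutes {1..n}"
  proof (rule bij_imp_permutes)
    show "bij_betw (\<lambda>x. if x \<in> {1..n} then f x else x) {1..n} {1..n}"
      using assms by (subst bij_betw_cong[where g = f]) auto
  qed auto
qed auto

lemma permutes_mapping_subset:
  fixes n :: nat
  assumes "S \<subseteq> {1..n}" "S' \<subseteq> {1..n}" "card S = card S'"
  shows "\<exists>p. p permutes {1..n} \<and> p ` S = S'"
proof -
  have fin: "finite S" "finite S'"
    using assms(1,2) finite_subset[OF _ finite_atLeastAtMost] by auto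
  obtain f where f: "bij_betw f S S'"
    using fin assms(3) finite_same_card_bij by blast
  have "card ({1..n} - S) = card ({1..n} - S')"
    using assms fin by (simp add: card_Diff_subset)
  then obtain g where g: "bij_betw g ({1..n} - S) ({1..n} - S')"
    using finite_same_card_bij[OF finite_Diff[OF finite_atLeastAtMost] finite_Diff[OF finite_atLeastAtMost]]
    by blast
  have "bij_betw (\<lambda>x. if x \<in> S then f x else g x) (S \<union> ({1..n} - S)) (S' \<union> ({1..n} - S'))"
    by (intro bij_betw_disjoint_Un f g) auto
  hence "bij_betw (\<lambda>x. if x \<in> S then f x else g x) {1..n} {1..n}"
    using assms by (simp add: Un_absorb1)
  from permutes_extending_bij_betw[OF this] obtain p where
    p: "p permutes {1..n}" "\<forall>x\<in>{1..n}. p x = (if x \<in> S then f x else g x)"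
    by blast
  have "p ` S = f ` S"
    using p(2) assms(1) by (intro image_cong) auto
  also have "\<dots> = S'"
    using f by (simp add: bij_betw_def)
  finally show ?thesis
    using p(1) by blast
qed

text \<open>
  The image of \<open>S\<close> is a uniformly random set of its cardinality.
\<close>

lemma prob_image_subset:
  assumes "S \<subseteq> {1..n}" "T \<subseteq> {1..n}"
  shows "measure_pmf.prob (uniform_perm n) {p. p ` S \<subseteq> T} = (card T choose card S) / (n choose card S)"
proof -
  let ?X = "{S'. S' \<subseteq> {1..n} \<and> card S' = card S}" and ?Y = "{S'. S' \<subseteq> T \<and> card S' = card S}"
  have "measure_pmf.prob (uniform_perm n) {p. (`) p S \<in> ?Y} = card ?Y / card ?X"
  proof (rule prob_transitive_action)
    fix p :: perm and S' assume "p permutes {1..n}" "S' \<in> ?X"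
    thus "p ` S' \<in> ?X"
      using permutes_in_image[of p "{1..n}"]
      by (auto simp: card_image permutes_inj_on)
  next
    show "\<exists>p. p permutes {1..n} \<and> p ` S1 = S2" if "S1 \<in> ?X" "S2 \<in> ?X" for S1 S2
      using that by (intro permutes_mapping_subset) auto
  qed (use assms in auto)
  also have "measure_pmf.prob (uniform_perm n) {p. (`) p S \<in> ?Y} =
      measure_pmf.prob (uniform_perm n) {p. p ` S \<subseteq> T}"
  proof (rule measure_pmf.finite_measure_eq_AE)
    have "card (p ` S) = card S" if "p \<in> carrier (sym_group n)" for p
      using that by (metis card_image carrier_sym_group mem_Collect_eq permutes_inj_on)
    thus "AE p in uniform_perm n. p \<in> {p. p ` S \<in> ?Y} \<longleftrightarrow> p \<in> {p. p ` S \<subseteq> T}"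
      using finite_carrier_sym_group carrier_sym_group_nonempty
      by (simp add: AE_measure_pmf_iff)
  qed auto
  finally show ?thesis
    using assms finite_subset[OF assms(2)] by (simp add: n_subsets)
qed


section \<open>Expansion of the action on points\<close>

text \<open>
  The strict inequality with the rounded-down fraction says at the same time that even the smallest
  sets grow, by at least one point, and that larger sets grow by the constant factor \<open>65/64\<close>. Any
  small enough fraction would do for the union bound; the numerical estimates below work for \<open>64\<close>.
\<close>

definition expanding :: "nat \<Rightarrow> perm \<Rightarrow> perm \<Rightarrow> bool" where
  "expanding n f g \<longleftrightarrow>
     (\<forall>S \<subseteq> {1..n}. S \<noteq> {} \<and> 2 * card S \<le> n \<longrightarrow>
        card S + card S div 64 < card (S \<union> f ` S \<union> g ` S))"

text \<open>
  One term of the binomial expansion of \<open>(1/16 + 1)\<^bsup>s + r\<^esup>\<close> is at most the whole sum.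
\<close>

lemma binomial_le_power:
  "real ((s + r) choose r) \<le> (17/16) ^ s * 17 ^ r"
proof -
  have "real ((s + r) choose r) * (1/16) ^ r * 1 ^ (s + r - r) \<le>
      (\<Sum>i\<le>s + r. real ((s + r) choose i) * (1/16) ^ i * 1 ^ (s + r - i))"
    by (rule member_le_sum[of r "{..s+r}" "\<lambda>i. real ((s + r) choose i) * (1/16) ^ i * 1 ^ (s + r - i)"]) auto
  also have "\<dots> = (1/16 + 1) ^ (s + r)"
    by (rule binomial_ring[symmetric])
  finally have "real ((s + r) choose r) * (1/16) ^ r * 16 ^ r \<le> (17/16) ^ (s + r) * 16 ^ r"
    by (intro mult_right_mono) auto
  also have "real ((s + r) choose r) * (1/16) ^ r * 16 ^ r = real ((s + r) choose r)"
    by (simp add: power_one_over)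
  finally have "real ((s + r) choose r) \<le> (17/16) ^ (s + r) * 16 ^ r" .
  also have "\<dots> = (17/16) ^ s * 17 ^ r"
    by (simp add: power_add power_mult_distrib[symmetric])
  finally show ?thesis .
qed

text \<open>
  The left-hand side is the expected number of pairs \<open>(S, U)\<close> of sets of sizes \<open>s\<close> and \<open>s div 64\<close>
  such that two random permutations map \<open>S\<close> into \<open>S \<union> U\<close>. Up to the factor
  \<open>(s + r choose r)\<^sup>3 \<le> (3/2)\<^sup>s\<close>, it is at most the reciprocal of \<open>(n - r) choose (s - r)\<close>. Since \<open>n / s \<ge> 2\<close>, that binomial coefficient is both
  exponentially large in \<open>s\<close> and at least linear in \<open>n\<close>; both are needed, to sum over \<open>s\<close> and to
  let the sum tend to \<open>0\<close>.
\<close>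

lemma expansion_failure_bound:
  fixes n s :: nat
  assumes "s \<ge> 1" "2 * s \<le> n"
  defines "r \<equiv> s div 64"
  shows "(n choose s) * (n choose r) * (((s + r) choose s) / (n choose s))\<^sup>2 \<le>
    (2 * real s / n) * (3/4 :: real) ^ s"
proof -
  define c where "c = real ((s + r) choose r)"
  define D where "D = real ((n - r) choose (s - r))"
  have r: "r < s" "r \<le> n"
    using assms by auto
  have c_eq: "real ((s + r) choose s) = c"
    unfolding c_def using binomial_symmetric[of s "s + r"] by simp
  have C_pos: "real (n choose s) > 0" and c_pos: "c > 0"
    using assms by (auto simp: c_def)
  have "(n choose s) * (s choose r) = (n choose r) * ((n - r) choose (s - r))"
    using r assms by (intro choose_mult) auto
  hence mult: "real (n choose s) * real (s choose r) = real (n choose r) * D"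
    unfolding D_def by (metis of_nat_mult)
  have sr: "real (s choose r) \<le> c"
    unfolding c_def by (intro of_nat_mono binomial_right_mono) auto
  have ns: "real n / real s \<ge> 2"
    using assms by (simp add: field_simps)
  \<comment> \<open>One factor n / s is kept, for the decay in n; the others are bounded by 2, for the decay in s.\<close>
  have "(real n / real s) * 2 ^ (s - r - 1) \<le> (real n / real s) * (real n / real s) ^ (s - r - 1)"
    using ns by (intro mult_left_mono power_mono) auto
  also have "\<dots> = (real n / real s) ^ (s - r)"
    using r by (metis Suc_diff_1 power_Suc zero_less_diff)
  also have "\<dots> \<le> (real (n - r) / real (s - r)) ^ (s - r)"
  proof (intro power_mono)
    have "real n * real (s - r) \<le> real (n - r) * real s"
      using r assms mult_right_mono[of "real s" "real n" "real r"]
      by (simp add: of_nat_diff algebra_simps)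
    thus "real n / real s \<le> real (n - r) / real (s - r)"
      using r by (simp add: field_simps)
  qed auto
  also have "\<dots> \<le> D"
    unfolding D_def using assms by (intro binomial_ge_n_over_k_pow_k) auto
  finally have D: "(real n / real s) * 2 ^ (s - r - 1) \<le> D" .
  have base_pos: "(real n / real s) * 2 ^ (s - r - 1) > 0"
    using ns by (intro mult_pos_pos) auto
  hence D_pos: "D > 0"
    using D by linarith
  have "(n choose s) * (n choose r) * (((s + r) choose s) / (n choose s))\<^sup>2
      = real (n choose r) * c\<^sup>2 / real (n choose s)"
    using C_pos unfolding c_eq by (simp add: power2_eq_square field_simps)
  also have "\<dots> = real (s choose r) * c\<^sup>2 / D"
    using mult C_pos D_pos by (simp add: field_simps)
  also have "\<dots> \<le> c * c\<^sup>2 / ((real n / real s) * 2 ^ (s - r - 1))"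
    using sr c_pos D base_pos by (intro frac_le mult_right_mono) auto
  also have "\<dots> = (2 * real s / real n) * (c ^ 3 * 2 ^ r / 2 ^ s)"
  proof -
    have "(2::real) ^ s = 2 ^ (s - r - 1) * 2 ^ r * 2"
      using r by (simp flip: power_add power_Suc2)
    thus ?thesis
      using assms by (simp add: power3_eq_cube power2_eq_square field_simps)
  qed
  also have "\<dots> \<le> (2 * real s / real n) * (3/4) ^ s"
  proof (intro mult_left_mono)
    have "c ^ 3 \<le> ((17/16) ^ s * 17 ^ r) ^ 3"
      using binomial_le_power[of s r] c_pos unfolding c_def by (intro power_mono) auto
    hence "c ^ 3 * 2 ^ r / 2 ^ s \<le> ((17/16) ^ s * 17 ^ r) ^ 3 * 2 ^ r / 2 ^ s"
      by (intro divide_right_mono mult_right_mono) auto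
    also have "\<dots> = ((17/16) ^ 3 / 2) ^ s * (17 ^ 3 * 2) ^ r"
    proof -
      have "(x ^ m) ^ 3 = (x ^ 3) ^ m" for x :: real and m
        by (simp only: power_mult[symmetric] mult.commute)
      thus ?thesis
        unfolding power_mult_distrib power_divide[of _ 2] by (simp only: ac_simps times_divide_eq_right)
    qed
    \<comment> \<open>The fraction 1/64 is chosen so that the factor 17 ^ 3 * 2 = 9826 per element of U stays
      below (5/4) ^ 64.\<close>
    also have "\<dots> \<le> (3/5) ^ s * ((5/4) ^ 64) ^ r"
      by (intro mult_mono power_mono) (auto simp: power_divide)
    also have "((5/4 :: real) ^ 64) ^ r = (5/4) ^ (64 * r)"
      by (simp add: power_mult)
    also have "(5/4 :: real) ^ (64 * r) \<le> (5/4) ^ s"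
      unfolding r_def by (intro power_increasing) auto
    also have "(3/5) ^ s * (5/4 :: real) ^ s = (3/4) ^ s"
      by (simp add: power_mult_distrib[symmetric])
    finally show "c ^ 3 * 2 ^ r / 2 ^ s \<le> (3/4) ^ s" by simp
  qed auto
  finally show ?thesis .
qed

lemma arithmetic_geometric_sum_le:
  "(\<Sum>s=1..N. real s * (3/4) ^ s) \<le> 12 - (3 * real N + 12) * (3/4) ^ N"
proof (induction N)
  case (Suc N)
  have "real (Suc N) * (3/4) ^ Suc N + (3 * real (Suc N) + 12) * (3/4) ^ Suc N =
      (3 * real N + 12) * (3/4) ^ N"
    by (simp add: field_simps)
  thus ?case
    using Suc by simp
qed simp

text \<open>
  If \<open>S\<close> fails to expand, then \<open>S\<close> and its two images lie in a set \<open>S \<union> U\<close> with exactly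
  \<open>card S div 64\<close> elements of \<open>U\<close> outside \<open>S\<close>. The union bound runs over all pairs \<open>(S, U)\<close>.
\<close>

lemma prob_not_expanding:
  assumes k: "k \<ge> 2" and n: "n \<ge> 1"
  shows "measure_pmf.prob (random_generators k n) {s. \<not> expanding n (s 1) (s 2)} \<le> 24 / n"
proof -
  let ?P = "measure_pmf.prob (random_generators k n)"
  define I where "I s = {(S, U). S \<subseteq> {1..n} \<and> card S = s \<and> U \<subseteq> {1..n} \<and> card U = s div 64}" for s
  define E where "E s = {g :: nat \<Rightarrow> perm. \<exists>(S, U) \<in> I s. g 1 ` S \<subseteq> S \<union> U \<and> g 2 ` S \<subseteq> S \<union> U}" for s
  have I_eq: "I s = {S. S \<subseteq> {1..n} \<and> card S = s} \<times> {U. U \<subseteq> {1..n} \<and> card U = s div 64}" for s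
    by (auto simp: I_def)
  have cardI: "card (I s) = (n choose s) * (n choose (s div 64))" for s
    unfolding I_eq card_cartesian_product by (simp add: n_subsets)
  have finI: "finite (I s)" for s
    unfolding I_eq by (intro finite_cartesian_product) auto
  have PE: "?P (E s) \<le> (2 * real s / n) * (3/4) ^ s" if s: "s \<in> {1..n div 2}" for s
  proof -
    have "?P (E s) = ?P {g. \<exists>x\<in>I s. g 1 \<in> {p. p ` fst x \<subseteq> fst x \<union> snd x} \<and>
        g 2 \<in> {p. p ` fst x \<subseteq> fst x \<union> snd x}}"
      unfolding E_def case_prod_unfold by simp
    also have "\<dots> \<le> (\<Sum>x\<in>I s. (measure_pmf.prob (uniform_perm n) {p. p ` fst x \<subseteq> fst x \<union> snd x})\<^sup>2)"
      using k finI by (rule prob_union_bound)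
    also have "\<dots> \<le> (\<Sum>x\<in>I s. (((s + s div 64) choose s) / (n choose s))\<^sup>2)"
    proof (intro sum_mono power_mono)
      fix x assume "x \<in> I s"
      then obtain S U where x: "x = (S, U)" "S \<subseteq> {1..n}" "card S = s" "U \<subseteq> {1..n}" "card U = s div 64"
        by (auto simp: I_def)
      have "measure_pmf.prob (uniform_perm n) {p. p ` S \<subseteq> S \<union> U} = (card (S \<union> U) choose s) / (n choose s)"
        using x prob_image_subset[of S n "S \<union> U"] by simp
      also have "\<dots> \<le> ((s + s div 64) choose s) / (n choose s)"
        using x card_Un_le[of S U]
        by (intro divide_right_mono of_nat_mono binomial_right_mono) auto
      finally show "measure_pmf.prob (uniform_perm n) {p. p ` fst x \<subseteq> fst x \<union> snd x} \<le>
          ((s + s div 64) choose s) / (n choose s)"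
        by (simp add: x)
    qed auto
    also have "\<dots> = (n choose s) * (n choose (s div 64)) * (((s + s div 64) choose s) / (n choose s))\<^sup>2"
      by (simp add: cardI)
    also have "\<dots> \<le> (2 * real s / n) * (3/4) ^ s"
      using s by (intro expansion_failure_bound) auto
    finally show ?thesis by simp
  qed
  have in_E: "g \<in> (\<Union>s\<in>{1..n div 2}. E s)"
    if g: "g \<in> set_pmf (random_generators k n)" and ne: "\<not> expanding n (g 1) (g 2)" for g
  proof -
    have perm: "g 1 permutes {1..n}" "g 2 permutes {1..n}"
      using random_generators_permute[OF g] k by auto
    obtain S where S: "S \<subseteq> {1..n}" "S \<noteq> {}" "2 * card S \<le> n"
      "card (S \<union> g 1 ` S \<union> g 2 ` S) \<le> card S + card S div 64"
      using ne by (auto simp: expanding_def not_less)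
    let ?W = "S \<union> g 1 ` S \<union> g 2 ` S"
    have finS: "finite S"
      using S(1) by (auto intro: finite_subset)
    have sub: "?W \<subseteq> {1..n}"
      using S(1) perm by (auto dest: permutes_in_image)
    have "card S + card S div 64 \<le> n"
      using S(3) by simp
    then obtain T where T: "?W \<subseteq> T" "T \<subseteq> {1..n}" "card T = card S + card S div 64"
      using S(4) sub exists_subset_between[of ?W "card S + card S div 64" "{1..n}"] by auto
    have "card (T - S) = card S div 64"
      using T finS by (simp add: card_Diff_subset)
    hence "(S, T - S) \<in> I (card S)"
      using S(1) T(2) by (auto simp: I_def)
    moreover have "g 1 ` S \<subseteq> S \<union> (T - S)" "g 2 ` S \<subseteq> S \<union> (T - S)"
      using T(1) by auto
    ultimately have "g \<in> E (card S)"
      unfolding E_def by blast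
    moreover have "card S \<ge> 1"
      using S(2) finS by (simp add: Suc_le_eq card_gt_0_iff)
    ultimately show ?thesis
      using S(3) by auto
  qed
  have "?P {g. \<not> expanding n (g 1) (g 2)} \<le> ?P (\<Union>s\<in>{1..n div 2}. E s)"
    using in_E by (intro measure_pmf.finite_measure_mono_AE) (auto simp: AE_measure_pmf_iff)
  also have "\<dots> \<le> (\<Sum>s=1..n div 2. ?P (E s))"
    by (intro measure_pmf.finite_measure_subadditive_finite) auto
  also have "\<dots> \<le> (\<Sum>s=1..n div 2. (2 * real s / n) * (3/4) ^ s)"
    by (intro sum_mono PE)
  also have "\<dots> = (2 / n) * (\<Sum>s=1..n div 2. real s * (3/4) ^ s)"
    by (simp add: sum_distrib_left field_simps)
  also have "\<dots> \<le> (2 / n) * 12"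
    using arithmetic_geometric_sum_le[of "n div 2"]
    by (intro mult_left_mono order_trans[OF arithmetic_geometric_sum_le]) auto
  finally show ?thesis by simp
qed


section \<open>Invariant uniform partitions\<close>

definition uniform_partitions :: "nat \<Rightarrow> nat \<Rightarrow> nat set set set" where
  "uniform_partitions n m = {P. partition_on {1..n} P \<and> (\<forall>B\<in>P. card B = m)}"

text \<open>
  Only nontrivial block systems count: blocks have at least two points, and there are at least two
  of them.
\<close>

definition preserves_uniform_partition :: "nat \<Rightarrow> perm \<Rightarrow> perm \<Rightarrow> bool" where
  "preserves_uniform_partition n f g \<longleftrightarrow>
     (\<exists>m P. 2 \<le> m \<and> 2 * m \<le> n \<and> P \<in> uniform_partitions n m \<and>
        (`) f ` P = P \<and> (`) g ` P = P)"

lemma finite_uniform_partitions: "finite (uniform_partitions n m)"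
  using finitely_many_partition_on[of "{1..n}"]
  by (rule rev_finite_subset) (auto simp: uniform_partitions_def)

lemma uniform_partition_finite:
  assumes "P \<in> uniform_partitions n m"
  shows "finite P" "B \<in> P \<Longrightarrow> finite B" "B \<in> P \<Longrightarrow> B \<subseteq> {1..n}"
proof -
  have P: "partition_on {1..n} P"
    using assms by (simp add: uniform_partitions_def)
  show "finite P"
    by (rule finite_elements[OF _ P]) simp
  show "B \<subseteq> {1..n}" if "B \<in> P" for B
    using partition_onD1[OF P] that by blast
  thus "finite B" if "B \<in> P" for B
    using that finite_subset[OF _ finite_atLeastAtMost] by metis
qed

lemma card_uniform_partition:
  assumes "P \<in> uniform_partitions n m"
  shows "m * card P = n"
proof -
  have P: "\<Union>P = {1..n}" "disjoint P"
    using assms by (auto simp: uniform_partitions_def partition_on_def)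
  have "m * card P = card (\<Union>P)"
  proof (rule card_partition)
    show "finite P"
      using assms by (rule uniform_partition_finite)
    show "card B = m" if "B \<in> P" for B
      using assms that by (auto simp: uniform_partitions_def)
    show "B \<inter> B' = {}" if "B \<in> P" "B' \<in> P" "B \<noteq> B'" for B B'
      using P(2) that by (auto simp: disjoint_def)
  qed (simp add: P)
  thus ?thesis
    by (simp add: P)
qed

lemma uniform_partitions_closed:
  assumes p: "p permutes {1..n}" and P: "P \<in> uniform_partitions n m"
  shows "(`) p ` P \<in> uniform_partitions n m"
proof -
  have part: "partition_on {1..n} P"
    using P by (simp add: uniform_partitions_def)
  have "partition_on (p ` {1..n}) ((`) p ` P - {{}})"
    by (rule partition_on_inj_image[OF part permutes_inj_on[OF p]])
  hence "partition_on {1..n} ((`) p ` P - {{}})"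
    by (simp only: permutes_image[OF p])
  moreover have "{} \<notin> (`) p ` P"
    using partition_onD3[OF part] by auto
  moreover have "card (p ` B) = card B" for B
    by (rule card_image[OF permutes_inj_on[OF p]])
  ultimately show ?thesis
    using P by (simp add: uniform_partitions_def)
qed

text \<open>
  Match the blocks of the two partitions, then the points of matched blocks.
\<close>

lemma uniform_partitions_transitive:
  assumes P: "P \<in> uniform_partitions n m" and Q: "Q \<in> uniform_partitions n m" and m: "m > 0"
  shows "\<exists>p. p permutes {1..n} \<and> (`) p ` P = Q"
proof -
  have part: "partition_on {1..n} P" "partition_on {1..n} Q"
    using P Q by (auto simp: uniform_partitions_def)
  have "m * card P = m * card Q"
    using card_uniform_partition P Q by simp
  hence "card P = card Q"
    using m by simp
  then obtain \<beta> where \<beta>: "bij_betw \<beta> P Q"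
    using finite_same_card_bij[OF uniform_partition_finite(1)[OF P] uniform_partition_finite(1)[OF Q]]
    by blast
  have "\<exists>h. bij_betw h B (\<beta> B)" if B: "B \<in> P" for B
  proof (rule finite_same_card_bij)
    have "\<beta> B \<in> Q"
      using \<beta> B by (auto simp: bij_betw_def)
    thus "finite B" "finite (\<beta> B)" "card B = card (\<beta> B)"
      using uniform_partition_finite[OF P] uniform_partition_finite[OF Q] P Q B
      by (auto simp: uniform_partitions_def)
  qed
  then obtain h where h: "\<And>B. B \<in> P \<Longrightarrow> bij_betw (h B) B (\<beta> B)"
    by metis
  define F where "F x = h (THE B. B \<in> P \<and> x \<in> B) x" for x
  have F: "F x = h B x" if "B \<in> P" "x \<in> B" for B x
  proof -
    have "(THE B. B \<in> P \<and> x \<in> B) = B"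
      using that partition_onD2[OF part(1)] by (intro the_equality) (auto simp: disjoint_def)
    thus ?thesis
      by (simp add: F_def)
  qed
  have bijF: "bij_betw F B (\<beta> B)" if "B \<in> P" for B
    using h[OF that] F[OF that] by (subst bij_betw_cong[where g = "h B"]) auto
  have "bij_betw F (\<Union>B\<in>P. B) (\<Union>B\<in>P. \<beta> B)"
  proof (rule bij_betw_UNION_disjoint[OF _ bijF])
    show "disjoint_family_on \<beta> P"
      unfolding disjoint_family_on_def
    proof (intro ballI impI)
      fix B B' assume B: "B \<in> P" "B' \<in> P" "B \<noteq> B'"
      have "\<beta> B \<in> Q" "\<beta> B' \<in> Q" "\<beta> B \<noteq> \<beta> B'"
        using \<beta> B by (auto simp: bij_betw_def inj_on_def)
      thus "\<beta> B \<inter> \<beta> B' = {}"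
        using partition_onD2[OF part(2)] by (simp add: disjoint_def)
    qed
  qed
  moreover have "(\<Union>B\<in>P. B) = {1..n}"
    using partition_onD1[OF part(1)] by simp
  moreover have "(\<Union>B\<in>P. \<beta> B) = {1..n}"
    using partition_onD1[OF part(2)] bij_betw_imp_surj_on[OF \<beta>] by simp
  ultimately have "bij_betw F {1..n} {1..n}"
    by simp
  from permutes_extending_bij_betw[OF this] obtain p where
    p: "p permutes {1..n}" "\<forall>x\<in>{1..n}. p x = F x"
    by blast
  have "p ` B = \<beta> B" if B: "B \<in> P" for B
  proof -
    have "p ` B = F ` B"
      using p(2) uniform_partition_finite(3)[OF P B] by (intro image_cong) auto
    thus ?thesis
      using bijF[OF B] by (simp add: bij_betw_def)
  qed
  hence "(`) p ` P = \<beta> ` P"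
    by (intro image_cong) auto
  hence "(`) p ` P = Q"
    using \<beta> by (simp add: bij_betw_def)
  thus ?thesis
    using p(1) by blast
qed

text \<open>
  By symmetry every \<open>m\<close>-set is a block of some partition, and a partition has at most \<open>n\<close> blocks.
\<close>

lemma binomial_le_card_uniform_partitions:
  assumes P: "P \<in> uniform_partitions n m" and m: "m > 0" and n: "n > 0"
  shows "n choose m \<le> card (uniform_partitions n m) * n"
proof -
  let ?X = "uniform_partitions n m"
  have "{S. S \<subseteq> {1..n} \<and> card S = m} \<subseteq> \<Union>?X"
  proof
    fix S assume S: "S \<in> {S. S \<subseteq> {1..n} \<and> card S = m}"
    have "card P \<noteq> 0"
      using card_uniform_partition[OF P] n by (cases "card P") auto
    then obtain B where B: "B \<in> P"
      by (metis card.empty ex_in_conv)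
    have "card B = m"
      using B P by (auto simp: uniform_partitions_def)
    then obtain p where p: "p permutes {1..n}" "p ` B = S"
      using permutes_mapping_subset[of B n S] uniform_partition_finite(3)[OF P B] S by auto
    have "S \<in> (`) p ` P"
      using B p(2) by auto
    thus "S \<in> \<Union>?X"
      using uniform_partitions_closed[OF p(1) P] by blast
  qed
  moreover have finU: "finite (\<Union>?X)"
    using uniform_partition_finite(1) by (intro finite_Union finite_uniform_partitions)
  ultimately have "card {S. S \<subseteq> {1..n} \<and> card S = m} \<le> card (\<Union>?X)"
    by (intro card_mono)
  hence "n choose m \<le> card (\<Union>?X)"
    by (simp add: n_subsets)
  also have "\<dots> \<le> (\<Sum>Q\<in>?X. card Q)"
    using card_UN_le[OF finite_uniform_partitions, of "\<lambda>Q. Q"] by simp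
  also have "\<dots> \<le> (\<Sum>Q\<in>?X. n)"
  proof (intro sum_mono)
    fix Q assume "Q \<in> ?X"
    thus "card Q \<le> n"
      using card_uniform_partition[of Q n m] m by (cases m) auto
  qed
  finally show ?thesis by simp
qed

text \<open>
  The symmetric group permutes the \<open>N\<close> partitions with block size \<open>m\<close> transitively, so each is
  fixed by a random permutation with probability \<open>1 / N\<close>, and some partition is fixed by two
  independent permutations with probability at most \<open>N / N\<^sup>2\<close>. Block size \<open>2\<close> is treated apart: for
  it \<open>n / (n choose m)\<close> is only of order \<open>1 / n\<close>, which may not be summed over all \<open>m\<close>.
\<close>

lemma prob_preserves_uniform_partition:
  assumes k: "k \<ge> 2" and n: "n \<ge> 3"
  shows "measure_pmf.prob (random_generators k n) {s. preserves_uniform_partition n (s 1) (s 2)} \<le>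
    n / (n choose 2) + n * (n / (n choose 3))"
proof -
  let ?P = "measure_pmf.prob (random_generators k n)"
  define E where "E m = {s :: nat \<Rightarrow> perm. \<exists>P\<in>uniform_partitions n m.
    s 1 \<in> {p. (`) p ` P = P} \<and> s 2 \<in> {p. (`) p ` P = P}}" for m
  have PE: "?P (E m) \<le> n / (n choose m)" if m: "2 \<le> m" "2 * m \<le> n" for m
  proof (cases "uniform_partitions n m = {}")
    case False
    let ?X = "uniform_partitions n m"
    have fix_prob: "measure_pmf.prob (uniform_perm n) {p. (`) p ` P = P} = 1 / card ?X" if P: "P \<in> ?X" for P
    proof -
      have "measure_pmf.prob (uniform_perm n) {p. (\<lambda>p P. (`) p ` P) p P \<in> {P}} = card {P} / card ?X"
      proof (rule prob_transitive_action)
        show "(`) (p \<circ> q) ` Q = (`) p ` (`) q ` Q" for p q :: perm and Q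
          by (auto simp: image_comp image_image)
        show "\<exists>p. p permutes {1..n} \<and> (`) p ` Q = Q'" if "Q \<in> ?X" "Q' \<in> ?X" for Q Q'
          using that m by (intro uniform_partitions_transitive) auto
      qed (use P in \<open>auto simp: finite_uniform_partitions intro: uniform_partitions_closed\<close>)
      thus ?thesis by simp
    qed
    have "?P (E m) \<le> (\<Sum>P\<in>?X. (measure_pmf.prob (uniform_perm n) {p. (`) p ` P = P})\<^sup>2)"
      unfolding E_def by (rule prob_union_bound[OF k finite_uniform_partitions])
    also have "\<dots> = (\<Sum>P\<in>?X. (1 / card ?X)\<^sup>2)"
      by (intro sum.cong) (auto simp: fix_prob)
    also have "\<dots> = 1 / card ?X"
      by (simp add: power2_eq_square)
    also have "\<dots> \<le> n / (n choose m)"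
    proof -
      obtain P where "P \<in> ?X"
        using False by blast
      hence "n choose m \<le> card ?X * n"
        using m by (intro binomial_le_card_uniform_partitions) auto
      hence "real (n choose m) \<le> real (card ?X) * real n"
        by (metis of_nat_le_iff of_nat_mult)
      moreover have "card ?X > 0"
        using False finite_uniform_partitions by (simp add: card_gt_0_iff)
      moreover have "n choose m > 0"
        using m by simp
      ultimately show ?thesis
        by (simp add: field_simps)
    qed
    finally show ?thesis .
  qed (simp add: E_def)
  have PE': "?P (E m) \<le> n / (n choose 3)" if m: "m \<in> {3..n div 2}" for m
  proof -
    have "?P (E m) \<le> n / (n choose m)"
      using m by (intro PE) auto
    also have "\<dots> \<le> n / (n choose 3)"
      using m n by (intro divide_left_mono of_nat_mono binomial_mono) auto
    finally show ?thesis .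
  qed
  have PE2: "?P (E 2) \<le> n / (n choose 2)" if "4 \<le> n"
    using that by (intro PE) auto
  have "{s. preserves_uniform_partition n (s 1) (s 2)} \<subseteq> (\<Union>m\<in>{2..n div 2}. E m)"
  proof
    fix s :: "nat \<Rightarrow> perm" assume "s \<in> {s. preserves_uniform_partition n (s 1) (s 2)}"
    then obtain m P where "2 \<le> m" "2 * m \<le> n" and P: "P \<in> uniform_partitions n m"
      "(`) (s 1) ` P = P" "(`) (s 2) ` P = P"
      by (auto simp: preserves_uniform_partition_def)
    moreover have "s \<in> E m"
      unfolding E_def using P by blast
    ultimately show "s \<in> (\<Union>m\<in>{2..n div 2}. E m)"
      by (intro UN_I[of m]) auto
  qed
  hence "?P {s. preserves_uniform_partition n (s 1) (s 2)} \<le> ?P (\<Union>m\<in>{2..n div 2}. E m)"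
    by (intro measure_pmf.finite_measure_mono) auto
  also have "\<dots> \<le> (\<Sum>m=2..n div 2. ?P (E m))"
    by (intro measure_pmf.finite_measure_subadditive_finite) auto
  also have "\<dots> \<le> n / (n choose 2) + n * (n / (n choose 3))"
  proof (cases "4 \<le> n")
    case True
    hence "{2..n div 2} = insert 2 {3..n div 2}"
      by auto
    hence "(\<Sum>m=2..n div 2. ?P (E m)) = ?P (E 2) + (\<Sum>m=3..n div 2. ?P (E m))"
      by simp
    also have "(\<Sum>m=3..n div 2. ?P (E m)) \<le> (\<Sum>m=3..n div 2. n / (n choose 3))"
      by (intro sum_mono PE')
    also have "\<dots> \<le> n * (n / (n choose 3))"
      unfolding sum_constant by (intro mult_right_mono) auto
    finally show ?thesis
      using PE2[OF True] by simp
  next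
    case False
    hence "{2..n div 2} = {}"
      by auto
    thus ?thesis by simp
  qed
  finally show ?thesis .
qed


section \<open>Short words\<close>

text \<open>
  The ball of radius \<open>L\<close> around the identity in the word metric. All distances below are stated in
  this form, so that they add up under composition.
\<close>

definition expressible :: "nat \<Rightarrow> (nat \<Rightarrow> perm) \<Rightarrow> nat \<Rightarrow> perm \<Rightarrow> bool" where
  "expressible k s L g \<longleftrightarrow> (\<exists>w. set w \<subseteq> letters k \<and> length w \<le> L \<and> word_perm s w = g)"

lemma word_perm_simps [simp]:
  "word_perm s [] = id"
  "word_perm s (x # w) = letter_perm s x \<circ> word_perm s w"
  by (simp_all add: word_perm_def)

lemma word_perm_append: "word_perm s (v @ w) = word_perm s v \<circ> word_perm s w"
  by (induction v) (simp_all add: o_assoc)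

lemma inv_letter_in_letters [simp]: "inv_letter x \<in> letters k \<longleftrightarrow> x \<in> letters k"
  by (cases x) (simp add: letters_def)

locale permutation_generators =
  fixes n k :: nat and s :: "nat \<Rightarrow> perm"
  assumes generators_permute: "i \<in> {1..k} \<Longrightarrow> s i permutes {1..n}"
begin

lemma letter_perm_permutes:
  assumes "x \<in> letters k"
  shows "letter_perm s x permutes {1..n}"
proof (cases x)
  case (Pair i b)
  hence "s i permutes {1..n}"
    using assms generators_permute unfolding letters_def by blast
  thus ?thesis
    by (simp add: Pair permutes_inv)
qed

lemma letter_perm_inv_letter:
  assumes "x \<in> letters k"
  shows "letter_perm s (inv_letter x) = inv' (letter_perm s x)"
proof (cases x)
  case (Pair i b)
  hence "s i permutes {1..n}"
    using assms generators_permute unfolding letters_def by blast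
  thus ?thesis
    by (simp add: Pair inv_inv_eq permutes_bij)
qed

lemma word_perm_permutes:
  assumes "set w \<subseteq> letters k"
  shows "word_perm s w permutes {1..n}"
  using assms
proof (induction w)
  case (Cons x w)
  thus ?case
    unfolding word_perm_simps by (intro permutes_compose letter_perm_permutes) auto
qed (simp add: permutes_id)

lemma word_perm_inv_word:
  assumes "set w \<subseteq> letters k"
  shows "word_perm s (map inv_letter (rev w)) = inv' (word_perm s w)"
  using assms
proof (induction w)
  case (Cons x w)
  have "inv' (letter_perm s x \<circ> word_perm s w) = inv' (word_perm s w) \<circ> inv' (letter_perm s x)"
    using Cons.prems
    by (intro o_inv_distrib permutes_bij[OF letter_perm_permutes] permutes_bij[OF word_perm_permutes]) auto
  moreover have "word_perm s (map inv_letter (rev (x # w))) =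
      word_perm s (map inv_letter (rev w)) \<circ> letter_perm s (inv_letter x)"
    by (simp add: word_perm_append)
  moreover have "word_perm s (map inv_letter (rev w)) = inv' (word_perm s w)"
    "letter_perm s (inv_letter x) = inv' (letter_perm s x)"
    using Cons letter_perm_inv_letter[of x] by simp_all
  ultimately show ?case
    by (simp only: word_perm_simps)
qed simp

lemma expressible_permutes: "expressible k s L g \<Longrightarrow> g permutes {1..n}"
  using word_perm_permutes by (auto simp: expressible_def simp del: One_nat_def)

lemma expressible_mono: "expressible k s L g \<Longrightarrow> L \<le> L' \<Longrightarrow> expressible k s L' g"
  by (auto simp: expressible_def intro: order_trans)

lemma expressible_id: "expressible k s L id"
  unfolding expressible_def by (intro exI[of _ "[]"]) simp

lemma expressible_comp:
  assumes "expressible k s L g" "expressible k s L' h"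
  shows "expressible k s (L + L') (g \<circ> h)"
proof -
  obtain v w where "set v \<subseteq> letters k" "length v \<le> L" "word_perm s v = g"
      "set w \<subseteq> letters k" "length w \<le> L'" "word_perm s w = h"
    using assms by (auto simp: expressible_def)
  thus ?thesis
    unfolding expressible_def by (intro exI[of _ "v @ w"]) (simp add: word_perm_append)
qed

lemma expressible_inv:
  assumes "expressible k s L g"
  shows "expressible k s L (inv' g)"
proof -
  obtain w where w: "set w \<subseteq> letters k" "length w \<le> L" "word_perm s w = g"
    using assms by (auto simp: expressible_def)
  have "inv_letter x \<in> letters k" if "x \<in> set w" for x
    using that w(1) inv_letter_in_letters by blast
  hence "set (map inv_letter (rev w)) \<subseteq> letters k"
    unfolding set_map set_rev by blast
  thus ?thesis
    unfolding expressible_def using w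
    by (intro exI[of _ "map inv_letter (rev w)"]) (simp add: word_perm_inv_word)
qed

lemma expressible_conj:
  assumes "expressible k s L g" "expressible k s M h"
  shows "expressible k s (M + 2 * L) (g \<circ> h \<circ> inv' g)"
proof -
  have "expressible k s (L + M + L) (g \<circ> h \<circ> inv' g)"
    by (intro expressible_comp expressible_inv assms)
  thus ?thesis
    by (rule expressible_mono) simp
qed

lemma expressible_letter: "x \<in> letters k \<Longrightarrow> expressible k s 1 (letter_perm s x)"
  unfolding expressible_def by (intro exI[of _ "[x]"]) simp

lemma expressible_generator:
  assumes "i \<in> {1..k}"
  shows "expressible k s 1 (s i)"
  using expressible_letter[of "(i, True)"] assms by (simp add: letters_def)

lemma generated_eq: "generated n k s = {g. \<exists>L. expressible k s L g}"
proof (intro subset_antisym subsetI)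
  fix g assume "g \<in> generated n k s"
  hence "g \<in> generate (sym_group n) (s ` {1..k})"
    by (simp add: generated_def)
  hence "\<exists>L. expressible k s L g"
  proof induction
    case one
    show ?case
      unfolding sym_group_one using expressible_id by blast
  next
    case (incl h)
    thus ?case
      using expressible_generator by blast
  next
    case (inv h)
    then obtain i where i: "i \<in> {1..k}" "h = s i"
      by blast
    hence "h \<in> carrier (sym_group n)"
      using generators_permute by (simp add: carrier_sym_group)
    thus ?case
      using i expressible_inv[OF expressible_generator] by auto
  next
    case (eng g h)
    thus ?case
      unfolding sym_group_mult using expressible_comp by blast
  qed
  thus "g \<in> {g. \<exists>L. expressible k s L g}" by simp
next
  fix g assume "g \<in> {g. \<exists>L. expressible k s L g}"
  then obtain w where w: "set w \<subseteq> letters k" "word_perm s w = g"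
    by (auto simp: expressible_def)
  have "word_perm s w \<in> generate (sym_group n) (s ` {1..k})"
    using w(1)
  proof (induction w)
    case Nil
    show ?case
      using generate.one[of "sym_group n" "s ` {1..k}"] unfolding word_perm_simps sym_group_one .
  next
    case (Cons x w)
    obtain i b where x: "x = (i, b)" "i \<in> {1..k}"
      using Cons.prems by (cases x) (auto simp: letters_def)
    have "s i \<in> carrier (sym_group n)"
      using generators_permute x(2) by (simp add: carrier_sym_group)
    hence "letter_perm s x \<in> generate (sym_group n) (s ` {1..k})"
      using generate.incl[of "s i" "s ` {1..k}" "sym_group n"]
        generate.inv[of "s i" "s ` {1..k}" "sym_group n"] x by auto
    moreover have "word_perm s w \<in> generate (sym_group n) (s ` {1..k})"
      using Cons by simp
    ultimately show ?case
      unfolding word_perm_simps using generate.eng[of _ "sym_group n"] unfolding sym_group_mult by blast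
  qed
  thus "g \<in> generated n k s"
    using w(2) by (simp add: generated_def)
qed

lemma generated_comp: "g \<in> generated n k s \<Longrightarrow> h \<in> generated n k s \<Longrightarrow> g \<circ> h \<in> generated n k s"
  unfolding generated_eq using expressible_comp by blast

lemma generated_inv: "g \<in> generated n k s \<Longrightarrow> inv' g \<in> generated n k s"
  unfolding generated_eq using expressible_inv by blast

lemma generated_permutes: "g \<in> generated n k s \<Longrightarrow> g permutes {1..n}"
  unfolding generated_eq using expressible_permutes by blast

lemma generated_cycle_conj:
  assumes g: "g \<in> generated n k s" and xs: "cycle xs" "cycle_of_list xs \<in> generated n k s"
  shows "cycle_of_list (map g xs) \<in> generated n k s"
proof -
  have "g \<circ> cycle_of_list xs \<circ> inv' g = cycle_of_list (map g xs)"
    by (rule conjugation_of_cycle[OF xs(1) permutes_bij[OF generated_permutes[OF g]]])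
  thus ?thesis
    using generated_comp[OF generated_comp[OF g xs(2)] generated_inv[OF g]] by simp
qed


section \<open>Distances in the actions on points and on pairs\<close>

text \<open>
  While a ball contains at most half of the points, expansion enlarges it by the factor \<open>65/64\<close> per
  step, which amounts to doubling in \<open>64\<close> steps. After \<open>64 * lg\<close> steps both balls contain more than
  half of the points, so they intersect.
\<close>

lemma point_distance:
  assumes k: "k \<ge> 2" and exp: "expanding n (s 1) (s 2)" and n: "n \<le> 2 ^ lg"
    and ab: "a \<in> {1..n}" "b \<in> {1..n}"
  shows "\<exists>g. expressible k s (128 * lg) g \<and> g a = b"
proof -
  define B where "B j x = {g x | g. expressible k s j g}" for j x
  have B_sub: "B j x \<subseteq> {1..n}" if "x \<in> {1..n}" for j x
    unfolding B_def using that permutes_in_image[OF expressible_permutes] by blast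
  have finB: "finite (B j x)" if "x \<in> {1..n}" for j x
    using finite_subset[OF B_sub[OF that] finite_atLeastAtMost] .
  have B_ne: "x \<in> B j x" for j x
    unfolding B_def using expressible_id[of j] by (intro CollectI exI[of _ id]) simp
  have step: "B j x \<union> s 1 ` B j x \<union> s 2 ` B j x \<subseteq> B (Suc j) x" for j x
  proof -
    have "s i ` B j x \<subseteq> B (Suc j) x" if i: "i \<in> {1..k}" for i
    proof
      fix y assume "y \<in> s i ` B j x"
      then obtain g where g: "expressible k s j g" "y = s i (g x)"
        by (auto simp: B_def)
      have "expressible k s (Suc j) (s i \<circ> g)"
        using expressible_comp[OF expressible_generator[OF i] g(1)] by simp
      thus "y \<in> B (Suc j) x"
        unfolding B_def using g(2) by (intro CollectI exI[of _ "s i \<circ> g"]) simp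
    qed
    moreover have "B j x \<subseteq> B (Suc j) x"
      using expressible_mono[of j _ "Suc j"] by (auto simp: B_def)
    ultimately show ?thesis
      using k by auto
  qed
  have growth: "n < 2 * card (B j x) \<or> (65/64) ^ j \<le> real (card (B j x))" if x: "x \<in> {1..n}" for j x
  proof (induction j)
    case 0
    have "card (B 0 x) > 0"
      using B_ne[of x 0] finB[OF x] by (auto simp: card_gt_0_iff)
    thus ?case by auto
  next
    case (Suc j)
    let ?W = "B j x \<union> s 1 ` B j x \<union> s 2 ` B j x"
    have le: "card (B j x) \<le> card ?W" "card ?W \<le> card (B (Suc j) x)"
      using step[of j x] finB[OF x] by (auto intro!: card_mono)
    show ?case
    proof (cases "n < 2 * card (B j x)")
      case True
      thus ?thesis using le by linarith
    next
      case False
      have "card (B j x) + card (B j x) div 64 < card ?W"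
        using exp[unfolded expanding_def, rule_format, of "B j x"] False B_sub[OF x] B_ne[of x j] by auto
      hence "65 * card (B j x) \<le> 64 * card (B (Suc j) x)"
        using le(2) div_mult_mod_eq[of "card (B j x)" 64] mod_less_divisor[of 64 "card (B j x)"]
        by linarith
      hence "(65/64) * real (card (B j x)) \<le> real (card (B (Suc j) x))"
        by linarith
      moreover have "(65/64) ^ Suc j \<le> (65/64) * real (card (B j x))"
        using Suc False by simp
      ultimately show ?thesis by linarith
    qed
  qed
  have large: "n < 2 * card (B (64 * lg) x)" if x: "x \<in> {1..n}" for x
  proof -
    have "real n \<le> 2 ^ lg"
      using n by (metis of_nat_le_iff of_nat_numeral of_nat_power)
    \<comment> \<open>Here (1 + 1/64) ^ 64 is at least 2.\<close>
    also have "(2::real) ^ lg \<le> ((65/64) ^ 64) ^ lg"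
      by (intro power_mono) (auto simp: power_divide)
    also have "\<dots> = (65/64) ^ (64 * lg)"
      by (simp add: power_mult)
    finally have "real n \<le> (65/64) ^ (64 * lg)" .
    hence "n < 2 * card (B (64 * lg) x) \<or> n \<le> card (B (64 * lg) x)"
      using growth[OF x, of "64 * lg"] by linarith
    moreover have "n \<ge> 1"
      using x by simp
    ultimately show ?thesis by linarith
  qed
  have "B (64 * lg) a \<inter> B (64 * lg) b \<noteq> {}"
  proof
    assume disj: "B (64 * lg) a \<inter> B (64 * lg) b = {}"
    have "card (B (64 * lg) a) + card (B (64 * lg) b) = card (B (64 * lg) a \<union> B (64 * lg) b)"
      using disj finB ab by (simp add: card_Un_disjoint)
    also have "\<dots> \<le> card {1..n}"
      using B_sub ab by (intro card_mono) auto
    finally show False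
      using large[OF ab(1)] large[OF ab(2)] by simp
  qed
  then obtain g h where gh: "expressible k s (64 * lg) g" "expressible k s (64 * lg) h" "g a = h b"
    by (auto simp: B_def)
  have "(inv' h \<circ> g) a = b"
    using gh(3) permutes_inverses(2)[OF expressible_permutes[OF gh(2)]] by simp
  moreover have "expressible k s (64 * lg + 64 * lg) (inv' h \<circ> g)"
    by (intro expressible_comp expressible_inv gh)
  hence "expressible k s (128 * lg) (inv' h \<circ> g)"
    by simp
  ultimately show ?thesis by blast
qed

lemma increasing_chain_stabilizes:
  assumes "\<And>j. B j \<subseteq> B (Suc j)" "\<And>j. B j \<subseteq> V" "finite V"
  shows "\<exists>j \<le> card V. B (Suc j) = B j"
proof (rule ccontr)
  assume contra: "\<not> ?thesis"
  have fin: "finite (B j)" for j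
    by (rule finite_subset[OF assms(2,3)])
  have "j \<le> card (B j)" if "j \<le> Suc (card V)" for j
    using that
  proof (induction j)
    case (Suc j)
    hence "B j \<subset> B (Suc j)"
      using contra assms(1) by auto
    hence "card (B j) < card (B (Suc j))"
      by (rule psubset_card_mono[OF fin])
    thus ?case
      using Suc by simp
  qed simp
  from this[of "Suc (card V)"] show False
    using card_mono[OF assms(3,2), of "Suc (card V)"] by simp
qed

definition two_transitive :: bool where
  "two_transitive \<longleftrightarrow> (\<forall>a\<in>{1..n}. \<forall>b\<in>{1..n}. \<forall>a'\<in>{1..n}. \<forall>b'\<in>{1..n}. a \<noteq> b \<longrightarrow> a' \<noteq> b' \<longrightarrow>
      (\<exists>g \<in> generated n k s. g a = a' \<and> g b = b'))"

text \<open>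
  Schreier's argument. Let \<open>t x\<close> be a short element carrying the base point \<open>a\<close> to \<open>x\<close>. The elements
  \<open>(t (f x))\<^bsup>-1\<^esup> f (t x)\<close>, for letters \<open>f\<close>, fix \<open>a\<close> and have length at most \<open>2 * L + 1\<close>. The set of
  images of \<open>b\<close> under elements of the stabilizer of length at most \<open>j * (2 * L + 1)\<close> does not
  grow from \<open>j\<close> to \<open>j + 1\<close> for some \<open>j \<le> n\<close>. The set of pairs that it describes, seen from every possible base point, is then
  closed under all letters, and two-transitivity shows that it contains all pairs.
\<close>

lemma pair_distance:
  assumes two_trans: two_transitive
    and points: "\<And>a b. a \<in> {1..n} \<Longrightarrow> b \<in> {1..n} \<Longrightarrow> \<exists>g. expressible k s L g \<and> g a = b"
    and ab: "a \<in> {1..n}" "b \<in> {1..n}" "a \<noteq> b" "a' \<in> {1..n}" "b' \<in> {1..n}" "a' \<noteq> b'"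
  shows "\<exists>g. expressible k s (L + n * (2 * L + 1)) g \<and> g a = a' \<and> g b = b'"
proof -
  let ?D = "2 * L + 1"
  obtain t where t: "\<And>x. x \<in> {1..n} \<Longrightarrow> expressible k s L (t x) \<and> t x a = x"
    using points[OF ab(1)] by metis
  have t_perm: "t x permutes {1..n}" if "x \<in> {1..n}" for x
    using t[OF that] expressible_permutes by blast
  define U where "U j = {h b | h. expressible k s (j * ?D) h \<and> h a = a}" for j
  have U_step: "h ` U j \<subseteq> U (Suc j)" if h: "expressible k s ?D h" "h a = a" for h j
  proof
    fix y assume "y \<in> h ` U j"
    then obtain h' where h': "expressible k s (j * ?D) h'" "h' a = a" "y = h (h' b)"
      by (auto simp: U_def)
    have "expressible k s (Suc j * ?D) (h \<circ> h')"
      using expressible_comp[OF h(1) h'(1)] by (simp add: algebra_simps)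
    thus "y \<in> U (Suc j)"
      unfolding U_def using h h' by (intro CollectI exI[of _ "h \<circ> h'"]) simp
  qed
  have "\<exists>j \<le> card {1..n}. U (Suc j) = U j"
  proof (rule increasing_chain_stabilizes)
    show "U j \<subseteq> U (Suc j)" for j
      using U_step[OF expressible_id] by simp
    show "U j \<subseteq> {1..n}" for j
      unfolding U_def using ab(2) permutes_in_image[OF expressible_permutes] by blast
  qed simp
  then obtain j where j: "j \<le> n" "U (Suc j) = U j"
    by auto
  \<comment> \<open>The pair (x, y) is pulled back to one whose first point is the base point.\<close>
  define W where "W = {(x, y). x \<in> {1..n} \<and> inv' (t x) y \<in> U j}"
  have W_step: "(letter_perm s z x, letter_perm s z y) \<in> W" if xy: "(x, y) \<in> W" and z: "z \<in> letters k" for x y z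
  proof -
    let ?f = "letter_perm s z"
    have x: "x \<in> {1..n}" "?f x \<in> {1..n}" "inv' (t x) y \<in> U j"
      using xy permutes_in_image[OF letter_perm_permutes[OF z]] by (auto simp: W_def)
    let ?h = "inv' (t (?f x)) \<circ> ?f \<circ> t x"
    have "expressible k s (L + 1 + L) ?h"
      by (intro expressible_comp expressible_inv expressible_letter z) (use t x in auto)
    hence "expressible k s ?D ?h"
      by (rule expressible_mono) simp
    moreover have "?h a = a"
      using t[OF x(1)] t[OF x(2)] permutes_inv_eq[OF t_perm[OF x(2)]] by simp
    ultimately have "?h ` U j \<subseteq> U j"
      using U_step j(2) by metis
    hence "?h (inv' (t x) y) \<in> U j"
      using x(3) by blast
    moreover have "?h (inv' (t x) y) = inv' (t (?f x)) (?f y)"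
      using permutes_inverses(1)[OF t_perm[OF x(1)]] by simp
    ultimately show ?thesis
      using x(2) by (simp add: W_def)
  qed
  have W_word: "(word_perm s w x, word_perm s w y) \<in> W" if "set w \<subseteq> letters k" "(x, y) \<in> W" for w x y
    using that by (induction w) (auto intro: W_step)
  have b: "b \<in> U j"
    unfolding U_def using expressible_id by (intro CollectI exI[of _ id]) simp
  have "inv' (t a) (t a b) = b"
    using permutes_inverses(2)[OF t_perm[OF ab(1)]] by simp
  hence start: "(a, t a b) \<in> W"
    using b ab by (simp add: W_def)
  have "t a b \<noteq> a"
    using t[OF ab(1)] ab(3) permutes_inj[OF t_perm[OF ab(1)]] by (metis injD)
  moreover have "t a b \<in> {1..n}"
    using permutes_in_image[OF t_perm[OF ab(1)]] ab(2) by simp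
  ultimately obtain g where "g \<in> generated n k s" "g a = a'" "g (t a b) = b'"
    using two_trans[unfolded two_transitive_def, rule_format, of a "t a b" a' b'] ab by auto
  hence "(a', b') \<in> W"
    using W_word[OF _ start] by (auto simp: generated_eq expressible_def)
  then obtain h where h: "expressible k s (j * ?D) h" "h a = a" "h b = inv' (t a') b'"
    by (auto simp: W_def U_def)
  have "expressible k s (L + j * ?D) (t a' \<circ> h)"
    by (intro expressible_comp h) (use t ab in auto)
  hence "expressible k s (L + n * ?D) (t a' \<circ> h)"
    by (rule expressible_mono) (intro add_left_mono mult_le_mono1 j(1))
  moreover have "(t a' \<circ> h) a = a'" "(t a' \<circ> h) b = b'"
    using h t ab permutes_inverses(1)[OF t_perm[of a']] by auto
  ultimately show ?thesis by blast
qed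

end


section \<open>Cycles in the generated group\<close>

lemma three_cycle_apply:
  assumes "distinct [a, b, c]"
  shows "cycle_of_list [a, b, c] x = (if x = a then b else if x = b then c else if x = c then a else x)"
  using assms by (auto simp: transpose_def)

lemma inv_three_cycle:
  assumes "distinct [a, b, c]"
  shows "inv' (cycle_of_list [a, b, c]) = cycle_of_list [b, a, c]"
proof (rule inv_unique_comp)
  have d: "distinct [b, a, c]"
    using assms by auto
  show "cycle_of_list [a, b, c] \<circ> cycle_of_list [b, a, c] = id"
    "cycle_of_list [b, a, c] \<circ> cycle_of_list [a, b, c] = id"
    unfolding fun_eq_iff o_apply three_cycle_apply[OF d] three_cycle_apply[OF assms]
    using assms by auto
qed

lemma c_cycles_2: "c_cycles n 2 = {cycle_of_list [a, b] | a b. {a, b} \<subseteq> {1..n} \<and> a \<noteq> b}"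
proof (intro subset_antisym subsetI)
  fix \<tau> assume "\<tau> \<in> c_cycles n 2"
  then obtain xs where xs: "\<tau> = cycle_of_list xs" "distinct xs" "length xs = 2" "set xs \<subseteq> {1..n}"
    unfolding c_cycles_def by blast
  then obtain a b where "xs = [a, b]"
    by (auto simp: length_Suc_conv numeral_2_eq_2)
  hence "\<tau> = cycle_of_list [a, b]" "{a, b} \<subseteq> {1..n}" "a \<noteq> b"
    using xs by auto
  thus "\<tau> \<in> {cycle_of_list [a, b] | a b. {a, b} \<subseteq> {1..n} \<and> a \<noteq> b}"
    by blast
next
  fix \<tau> assume "\<tau> \<in> {cycle_of_list [a, b] | a b. {a, b} \<subseteq> {1..n} \<and> a \<noteq> b}"
  then obtain a b where "\<tau> = cycle_of_list [a, b]" "{a, b} \<subseteq> {1..n}" "a \<noteq> b"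
    by blast
  thus "\<tau> \<in> c_cycles n 2"
    unfolding c_cycles_def by (intro CollectI exI[of _ "[a, b]"]) simp
qed

lemma c_cycles_3:
  "c_cycles n 3 = {cycle_of_list [a, b, c] | a b c. {a, b, c} \<subseteq> {1..n} \<and> distinct [a, b, c]}"
proof (intro subset_antisym subsetI)
  fix \<tau> assume "\<tau> \<in> c_cycles n 3"
  then obtain xs where xs: "\<tau> = cycle_of_list xs" "distinct xs" "length xs = 3" "set xs \<subseteq> {1..n}"
    unfolding c_cycles_def by blast
  then obtain a b c where "xs = [a, b, c]"
    by (auto simp: length_Suc_conv numeral_3_eq_3)
  hence "\<tau> = cycle_of_list [a, b, c]" "{a, b, c} \<subseteq> {1..n}" "distinct [a, b, c]"
    using xs by auto
  thus "\<tau> \<in> {cycle_of_list [a, b, c] | a b c. {a, b, c} \<subseteq> {1..n} \<and> distinct [a, b, c]}"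
    by blast
next
  fix \<tau> assume "\<tau> \<in> {cycle_of_list [a, b, c] | a b c. {a, b, c} \<subseteq> {1..n} \<and> distinct [a, b, c]}"
  then obtain a b c where "\<tau> = cycle_of_list [a, b, c]" "{a, b, c} \<subseteq> {1..n}" "distinct [a, b, c]"
    by blast
  thus "\<tau> \<in> c_cycles n 3"
    unfolding c_cycles_def by (intro CollectI exI[of _ "[a, b, c]"]) simp
qed

context permutation_generators
begin

text \<open>
  Call \<open>y\<close> accessible from \<open>x\<close> if an element as short as a product of two of the given 3-cycles
  moves \<open>x\<close> to \<open>y\<close> and fixes \<open>a\<close> and \<open>b\<close>. The 3-cycle \<open>(x y t)\<close> shows that \<open>y\<close> is accessible unless \<open>t \<in> {a, b}\<close>. If there are two
  such cycles \<open>(x y t)\<close> and \<open>(x y' t)\<close> with the same \<open>t\<close>, then following the first by the inverse of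
  the second cancels the effect on \<open>t\<close>, and so \<open>y\<close> is accessible after all. Thus at most four points
  are inaccessible from \<open>x\<close>: the points \<open>a\<close>, \<open>b\<close>, and one for each choice of \<open>t\<close>. For \<open>n \<ge> 9\<close> some
  point is accessible from both \<open>z\<close> and \<open>c\<close>.
\<close>

lemma move_point_fixing_two_points:
  assumes n: "n \<ge> 9"
    and three_cycles: "\<And>x y. x \<in> {1..n} \<Longrightarrow> y \<in> {1..n} \<Longrightarrow> x \<noteq> y \<Longrightarrow>
      \<exists>z\<in>{1..n}. distinct [x, y, z] \<and> expressible k s K (cycle_of_list [x, y, z])"
    and pts: "a \<in> {1..n}" "b \<in> {1..n}" "z \<in> {1..n}" "c \<in> {1..n}" "z \<notin> {a, b}" "c \<notin> {a, b}"
  shows "\<exists>g. expressible k s (4 * K) g \<and> g a = a \<and> g b = b \<and> g z = c"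
proof -
  define M where "M x = {y \<in> {1..n}. \<exists>g. expressible k s (2 * K) g \<and> g a = a \<and> g b = b \<and> g x = y}" for x
  have big: "card ({1..n} - M x) \<le> 4" if x: "x \<in> {1..n}" "x \<notin> {a, b}" for x
  proof -
    define Y where "Y t = {y \<in> {1..n} - M x. y \<notin> {a, b} \<and> distinct [x, y, t] \<and>
      expressible k s K (cycle_of_list [x, y, t])}" for t
    have Y_unique: "y = y'" if t: "t \<in> {a, b}" and y: "y \<in> Y t" "y' \<in> Y t" for t y y'
    proof (rule ccontr)
      assume ne: "y \<noteq> y'"
      have d: "distinct [x, y, t]" "distinct [x, y', t]" "distinct [y', x, t]"
        using y by (auto simp: Y_def)
      let ?g = "inv' (cycle_of_list [x, y', t]) \<circ> cycle_of_list [x, y, t]"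
      have "expressible k s (K + K) ?g"
        by (intro expressible_comp expressible_inv) (use y in \<open>auto simp: Y_def\<close>)
      hence "expressible k s (2 * K) ?g"
        by (simp add: mult_2)
      moreover have g: "?g u = (if u = x then y else if u = y then y' else if u = y' then x else u)" for u
        unfolding inv_three_cycle[OF d(2)] o_apply three_cycle_apply[OF d(1)] three_cycle_apply[OF d(3)]
        using d ne by auto
      have "?g a = a" "?g b = b" "?g x = y"
        unfolding g using x y by (auto simp: Y_def)
      ultimately have "y \<in> M x"
        unfolding M_def using y(1) by (auto simp: Y_def)
      thus False
        using y(1) by (simp add: Y_def)
    qed
    have card_Y: "card (Y t) \<le> 1" if "t \<in> {a, b}" for t
    proof -
      have "finite (Y t)"
        by (simp add: Y_def)
      thus ?thesis
        using card_le_Suc0_iff_eq Y_unique[OF that] by (metis One_nat_def)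
    qed
    have "{1..n} - M x \<subseteq> {a, b} \<union> Y a \<union> Y b"
    proof
      fix y assume y: "y \<in> {1..n} - M x"
      have "x \<in> M x"
        unfolding M_def using x expressible_id by (intro CollectI conjI exI[of _ id]) auto
      hence "x \<noteq> y"
        using y by auto
      then obtain t where t: "t \<in> {1..n}" "distinct [x, y, t]" "expressible k s K (cycle_of_list [x, y, t])"
        using three_cycles[OF x(1), of y] y by auto
      show "y \<in> {a, b} \<union> Y a \<union> Y b"
      proof (rule ccontr)
        assume contra: "y \<notin> {a, b} \<union> Y a \<union> Y b"
        hence "t \<notin> {a, b}"
          using t y by (auto simp: Y_def)
        hence "cycle_of_list [x, y, t] a = a" "cycle_of_list [x, y, t] b = b" "cycle_of_list [x, y, t] x = y"
          unfolding three_cycle_apply[OF t(2)] using x contra by auto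
        moreover have "expressible k s (2 * K) (cycle_of_list [x, y, t])"
          by (rule expressible_mono[OF t(3)]) simp
        ultimately have "y \<in> M x"
          unfolding M_def using y by blast
        thus False
          using y by simp
      qed
    qed
    hence "card ({1..n} - M x) \<le> card ({a, b} \<union> Y a \<union> Y b)"
      by (intro card_mono) (auto simp: Y_def)
    also have "\<dots> \<le> card {a, b} + card (Y a) + card (Y b)"
      by (intro order_trans[OF card_Un_le] add_right_mono card_Un_le)
    also have "\<dots> \<le> 2 + 1 + 1"
      by (intro add_mono card_Y) (auto simp: card_insert_if)
    finally show ?thesis by simp
  qed
  have "M z \<inter> M c \<noteq> {}"
  proof
    assume "M z \<inter> M c = {}"
    moreover have "M c \<subseteq> {1..n}"
      unfolding M_def by (rule Collect_restrict)
    ultimately have "M c \<subseteq> {1..n} - M z"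
      by blast
    hence "card (M c) \<le> 4"
      using big[OF pts(3,5)] card_mono[of "{1..n} - M z" "M c"] by simp
    moreover have "card ({1..n} - M c) = n - card (M c)"
      by (subst card_Diff_subset) (auto simp: M_def)
    ultimately show False
      using big[OF pts(4,6)] n by simp
  qed
  then obtain d where d: "d \<in> M z" "d \<in> M c"
    by blast
  obtain g where g: "expressible k s (2 * K) g" "g a = a" "g b = b" "g z = d"
    using d(1) unfolding M_def by blast
  obtain h where h: "expressible k s (2 * K) h" "h a = a" "h b = b" "h c = d"
    using d(2) unfolding M_def by blast
  have inv_h: "inv' h (h u) = u" for u
    by (rule permutes_inverses(2)[OF expressible_permutes[OF h(1)]])
  have "expressible k s (2 * K + 2 * K) (inv' h \<circ> g)"
    by (intro expressible_comp expressible_inv g h)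
  moreover have "(inv' h \<circ> g) a = a" "(inv' h \<circ> g) b = b" "(inv' h \<circ> g) z = c"
    using inv_h[of a] inv_h[of b] inv_h[of c] g h by auto
  ultimately show ?thesis
    by (intro exI[of _ "inv' h \<circ> g"]) simp
qed

text \<open>
  In a transitive group the classes of an invariant equivalence relation have equal size. If they
  had at most \<open>n / 2\<close> points they would form an invariant uniform partition.
\<close>

lemma invariant_equivalence_total:
  assumes k: "k \<ge> 2"
    and refl: "\<And>x. rel x x"
    and sym: "\<And>x y. rel x y \<Longrightarrow> rel y x"
    and trans: "\<And>x y z. x \<in> {1..n} \<Longrightarrow> y \<in> {1..n} \<Longrightarrow> z \<in> {1..n} \<Longrightarrow> rel x y \<Longrightarrow> rel y z \<Longrightarrow> rel x z"
    and invariant: "\<And>g x y. g \<in> generated n k s \<Longrightarrow> rel x y \<Longrightarrow> rel (g x) (g y)"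
    and transitive: "\<And>a b. a \<in> {1..n} \<Longrightarrow> b \<in> {1..n} \<Longrightarrow> \<exists>g\<in>generated n k s. g a = b"
    and no_partition: "\<not> preserves_uniform_partition n (s 1) (s 2)"
    and nontrivial: "p \<in> {1..n}" "q \<in> {1..n}" "p \<noteq> q" "rel p q"
    and xy: "x \<in> {1..n}" "y \<in> {1..n}"
  shows "rel x y"
proof -
  define cl where "cl x = {y \<in> {1..n}. rel x y}" for x
  define P where "P = cl ` {1..n}"
  define m where "m = card (cl p)"
  have cl_eq: "cl u = cl v" if uv: "u \<in> {1..n}" "v \<in> {1..n}" "rel u v" for u v
  proof (intro subset_antisym subsetI)
    fix w assume "w \<in> cl u"
    thus "w \<in> cl v"
      using trans[OF uv(2,1) _ sym[OF uv(3)]] by (simp add: cl_def)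
  next
    fix w assume "w \<in> cl v"
    thus "w \<in> cl u"
      using trans[OF uv(1,2) _ uv(3)] by (simp add: cl_def)
  qed
  have cl_image: "cl (g u) = g ` cl u" if g: "g \<in> generated n k s" and u: "u \<in> {1..n}" for g u
  proof
    have perm: "g permutes {1..n}" "inv' g permutes {1..n}"
      using generated_permutes g generated_inv by auto
    show "g ` cl u \<subseteq> cl (g u)"
      unfolding cl_def using invariant[OF g] permutes_in_image[OF perm(1)] by blast
    show "cl (g u) \<subseteq> g ` cl u"
    proof
      fix v assume v: "v \<in> cl (g u)"
      hence "rel (inv' g (g u)) (inv' g v)"
        using invariant[OF generated_inv[OF g]] by (simp add: cl_def)
      hence "inv' g v \<in> cl u"
        using v permutes_in_image[OF perm(2)] permutes_inverses(2)[OF perm(1)] by (simp add: cl_def)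
      moreover have "g (inv' g v) = v"
        by (rule permutes_inverses(1)[OF perm(1)])
      ultimately show "v \<in> g ` cl u"
        by (metis imageI)
    qed
  qed
  have card_cl: "card (cl u) = m" if u: "u \<in> {1..n}" for u
  proof -
    obtain g where g: "g \<in> generated n k s" "g p = u"
      using transitive[OF nontrivial(1) u] by blast
    have "card (g ` cl p) = card (cl p)"
      by (rule card_image[OF permutes_inj_on[OF generated_permutes[OF g(1)]]])
    thus ?thesis
      using cl_image[OF g(1) nontrivial(1)] g(2) by (simp add: m_def)
  qed
  have P_image: "(`) (s i) ` P = P" if i: "i \<in> {1..k}" for i
  proof -
    have g: "s i \<in> generated n k s"
      unfolding generated_eq using expressible_generator[OF i] by blast
    have "(`) (s i) ` P = (\<lambda>u. cl (s i u)) ` {1..n}"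
      unfolding P_def image_image using cl_image[OF g] by (intro image_cong) auto
    also have "\<dots> = cl ` (s i ` {1..n})"
      by (simp only: image_image)
    also have "\<dots> = P"
      unfolding P_def permutes_image[OF generators_permute[OF i]] ..
    finally show ?thesis .
  qed
  have part: "partition_on {1..n} P"
  proof (rule partition_onI)
    show "\<Union>P = {1..n}"
      unfolding P_def cl_def using refl by auto
    show "{} \<notin> P"
      unfolding P_def cl_def using refl by auto
    fix B B' assume "B \<in> P" "B' \<in> P" and ne: "B \<noteq> B'"
    then obtain u v where uv: "u \<in> {1..n}" "v \<in> {1..n}" "B = cl u" "B' = cl v"
      unfolding P_def by blast
    show "disjnt B B'"
      unfolding disjnt_def
    proof (rule ccontr)
      assume "B \<inter> B' \<noteq> {}"
      then obtain w where w: "w \<in> {1..n}" "rel u w" "rel v w"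
        unfolding uv cl_def by blast
      hence "cl u = cl v"
        using cl_eq[OF uv(1) w(1)] cl_eq[OF uv(2) w(1)] by simp
      thus False
        using ne uv by simp
    qed
  qed
  hence unif: "P \<in> uniform_partitions n m"
    using card_cl by (auto simp: uniform_partitions_def P_def)
  have "card {p, q} \<le> card (cl p)"
    using nontrivial refl by (intro card_mono) (auto simp: cl_def)
  hence m: "m \<ge> 2"
    using nontrivial by (simp add: m_def)
  have "\<not> 2 * m \<le> n"
  proof
    assume le: "2 * m \<le> n"
    have "(`) (s 1) ` P = P" "(`) (s 2) ` P = P"
      by (rule P_image, use k in simp)+
    hence "preserves_uniform_partition n (s 1) (s 2)"
      unfolding preserves_uniform_partition_def using le m unif
      by (intro exI[of _ m] exI[of _ P] conjI)
    thus False
      using no_partition by contradiction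
  qed
  hence "m * card P < m * 2"
    using card_uniform_partition[OF unif] by simp
  hence "card P \<le> 1"
    by simp
  moreover have "finite P"
    by (simp add: P_def)
  moreover have "cl x \<in> P" "cl y \<in> P"
    using xy by (auto simp: P_def)
  ultimately have "cl x = cl y"
    using card_le_Suc0_iff_eq by (metis One_nat_def)
  thus ?thesis
    using refl xy by (auto simp: cl_def)
qed

text \<open>
  The relation of being equal or interchanged by a transposition of the group is transitive because
  \<open>(y z)\<close> conjugates \<open>(x y)\<close> to \<open>(x z)\<close>.
\<close>

lemma transposition_imp_symmetric:
  assumes k: "k \<ge> 2"
    and transitive: "\<And>a b. a \<in> {1..n} \<Longrightarrow> b \<in> {1..n} \<Longrightarrow> \<exists>g\<in>generated n k s. g a = b"
    and no_partition: "\<not> preserves_uniform_partition n (s 1) (s 2)"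
    and \<mu>: "\<mu> \<in> c_cycles n 2" "\<mu> \<in> generated n k s"
  shows "generated n k s = carrier (sym_group n)"
proof -
  define rel where "rel x y \<longleftrightarrow> x = y \<or> cycle_of_list [x, y] \<in> generated n k s" for x y
  obtain p q where pq: "\<mu> = cycle_of_list [p, q]" "{p, q} \<subseteq> {1..n}" "p \<noteq> q"
    using \<mu>(1) unfolding c_cycles_2 by blast
  have rel: "rel x y" if "x \<in> {1..n}" "y \<in> {1..n}" for x y
  proof (rule invariant_equivalence_total[OF k, of rel p q])
    show "rel x x" for x
      by (simp add: rel_def)
    show sym: "rel y x" if "rel x y" for x y
      using that by (auto simp: rel_def transpose_commute)
    show invariant: "rel (g x) (g y)" if g: "g \<in> generated n k s" and "rel x y" for g x y
      using that generated_cycle_conj[OF g, of "[x, y]"] by (cases "x = y") (auto simp: rel_def)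
    show "rel x z" if "rel x y" "rel y z" for x y z
    proof (cases "x = y \<or> y = z \<or> x = z")
      case False
      let ?h = "cycle_of_list [y, z]"
      have "rel (?h x) (?h y)"
        by (rule invariant) (use that False in \<open>auto simp: rel_def\<close>)
      thus ?thesis
        using False by (simp add: transpose_def)
    qed (use that in \<open>auto simp: rel_def\<close>)
    show "rel p q"
      using \<mu> pq by (simp add: rel_def)
  qed (use that transitive no_partition pq in auto)
  have "p \<in> generated n k s" if "p permutes {1..n}" for p
    using that finite_atLeastAtMost
  proof (induction rule: permutes_induct)
    case id
    show ?case
      unfolding generated_eq using expressible_id by blast
  next
    case (swap a b p)
    have "cycle_of_list [a, b] \<in> generated n k s"
      using rel[of a b] swap by (auto simp: rel_def)
    hence "Transposition.transpose a b \<in> generated n k s"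
      by simp
    thus ?case
      using swap generated_comp by blast
  qed
  thus ?thesis
    using generated_permutes by (auto simp: carrier_sym_group)
qed

text \<open>
  Turns membership in the generated group into a statement about words of bounded length, so that
  \<open>move_point_fixing_two_points\<close> applies to the 3-cycles of the group.
\<close>

lemma generated_bounded: "\<exists>K. \<forall>g\<in>generated n k s. expressible k s K g"
proof -
  have fin: "finite (generated n k s)"
    using generated_permutes by (intro finite_subset[OF _ finite_permutations[of "{1..n}"]]) auto
  have "\<forall>g\<in>generated n k s. \<exists>L. expressible k s L g"
    unfolding generated_eq by blast
  then obtain L where L: "\<And>g. g \<in> generated n k s \<Longrightarrow> expressible k s (L g) g"
    unfolding bchoice_iff by blast
  have "expressible k s (Max (L ` generated n k s)) g" if "g \<in> generated n k s" for g
    using L[OF that] by (rule expressible_mono) (use fin that in simp)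
  thus ?thesis by blast
qed

text \<open>
  As for transpositions, lying on a common 3-cycle of the group is an invariant equivalence
  relation, so any two distinct points lie on one. The third point of such a 3-cycle is unknown; it
  is moved to the desired place by an element of the group that fixes the other two.
\<close>

lemma three_cycle_imp_all_three_cycles:
  assumes k: "k \<ge> 2" and n: "n \<ge> 9"
    and transitive: "\<And>a b. a \<in> {1..n} \<Longrightarrow> b \<in> {1..n} \<Longrightarrow> \<exists>g\<in>generated n k s. g a = b"
    and no_partition: "\<not> preserves_uniform_partition n (s 1) (s 2)"
    and \<mu>: "\<mu> \<in> c_cycles n 3" "\<mu> \<in> generated n k s"
  shows "c_cycles n 3 \<subseteq> generated n k s"
proof -
  define T where "T x y z \<longleftrightarrow> distinct [x, y, z] \<and> {x, y, z} \<subseteq> {1..n} \<and>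
    cycle_of_list [x, y, z] \<in> generated n k s" for x y z
  define rel where "rel x y \<longleftrightarrow> x = y \<or> (\<exists>z. T x y z)" for x y
  have T_flip: "T y x z" if "T x y z" for x y z
  proof -
    have "cycle_of_list [y, x, z] = inv' (cycle_of_list [x, y, z])"
      using that inv_three_cycle[of x y z] by (simp add: T_def)
    thus ?thesis
      using that generated_inv by (auto simp: T_def simp del: cycle_of_list.simps)
  qed
  have T_rotate: "T y z x" if "T x y z" for x y z
  proof -
    have d: "distinct [x, y, z]" "distinct [y, z, x]"
      using that by (auto simp: T_def)
    have "cycle_of_list [y, z, x] = cycle_of_list [x, y, z]"
      unfolding fun_eq_iff three_cycle_apply[OF d(1)] three_cycle_apply[OF d(2)] using d by auto
    thus ?thesis
      using that by (auto simp: T_def simp del: cycle_of_list.simps)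
  qed
  have T_conj: "T (g x) (g y) (g z)" if g: "g \<in> generated n k s" and T: "T x y z" for g x y z
  proof -
    have "distinct (map g [x, y, z])"
      using T permutes_inj_on[OF generated_permutes[OF g]] by (subst distinct_map) (auto simp: T_def)
    moreover have "{g x, g y, g z} \<subseteq> {1..n}"
      using T permutes_in_image[OF generated_permutes[OF g]] unfolding T_def by blast
    moreover have "cycle_of_list (map g [x, y, z]) \<in> generated n k s"
      using T by (intro generated_cycle_conj[OF g]) (auto simp: T_def simp del: cycle_of_list.simps)
    ultimately show ?thesis
      by (simp add: T_def del: cycle_of_list.simps)
  qed
  obtain p q r where pqr: "\<mu> = cycle_of_list [p, q, r]" "{p, q, r} \<subseteq> {1..n}" "distinct [p, q, r]"
    using \<mu>(1) unfolding c_cycles_3 by blast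
  have rel: "rel x y" if "x \<in> {1..n}" "y \<in> {1..n}" for x y
  proof (rule invariant_equivalence_total[OF k, of rel p q])
    show "rel x x" for x
      by (simp add: rel_def)
    show "rel y x" if "rel x y" for x y
      using that T_flip by (auto simp: rel_def)
    show "rel (g x) (g y)" if g: "g \<in> generated n k s" and "rel x y" for g x y
      using that T_conj[OF g] by (auto simp: rel_def)
    show "rel x z" if xyz: "rel x y" "rel y z" for x y z
    proof (cases "x = y \<or> y = z \<or> x = z")
      case False
      then obtain u v where uv: "T x y u" "T y z v"
        using xyz by (auto simp: rel_def)
      show ?thesis
      proof (cases "u = z \<or> v = x")
        case True
        hence "T x z y \<or> T z x y"
          using uv T_rotate T_flip by blast
        thus ?thesis
          using T_flip by (auto simp: rel_def)
      next
        case outer: False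
        \<comment> \<open>If the third points of the two 3-cycles avoid z and x, the second cycle fixes x and carries
          y to z, so it conjugates the first one to a 3-cycle through x and z.\<close>
        let ?h = "cycle_of_list [y, z, v]"
        have d: "distinct [y, z, v]"
          using uv by (simp add: T_def)
        have "?h \<in> generated n k s"
          using uv by (simp add: T_def)
        hence "T (?h x) (?h y) (?h u)"
          using uv(1) by (rule T_conj)
        moreover have "?h x = x" "?h y = z"
          unfolding three_cycle_apply[OF d] using False outer by auto
        ultimately show ?thesis
          by (auto simp: rel_def simp del: cycle_of_list.simps)
      qed
    qed (use xyz in \<open>auto simp: rel_def\<close>)
    show "rel p q"
      using \<mu> pqr by (auto simp: rel_def T_def simp del: cycle_of_list.simps)
  qed (use that transitive no_partition pqr in auto)
  have ex: "\<exists>z. T x y z" if "x \<in> {1..n}" "y \<in> {1..n}" "x \<noteq> y" for x y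
    using rel[OF that(1,2)] that(3) by (simp add: rel_def)
  obtain K where K: "\<And>g. g \<in> generated n k s \<Longrightarrow> expressible k s K g"
    using generated_bounded by blast
  show ?thesis
  proof
    fix \<tau> assume "\<tau> \<in> c_cycles n 3"
    then obtain a b c where abc: "\<tau> = cycle_of_list [a, b, c]" "{a, b, c} \<subseteq> {1..n}" "distinct [a, b, c]"
      unfolding c_cycles_3 by blast
    then obtain z where z: "T a b z"
      using ex[of a b] by auto
    have "\<exists>g. expressible k s (4 * K) g \<and> g a = a \<and> g b = b \<and> g z = c"
    proof (rule move_point_fixing_two_points[OF n])
      show "\<exists>z\<in>{1..n}. distinct [x, y, z] \<and> expressible k s K (cycle_of_list [x, y, z])"
        if "x \<in> {1..n}" "y \<in> {1..n}" "x \<noteq> y" for x y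
        using ex[OF that] K by (auto simp: T_def simp del: cycle_of_list.simps)
    qed (use abc z in \<open>auto simp: T_def simp del: cycle_of_list.simps\<close>)
    then obtain g where g: "g \<in> generated n k s" "g a = a" "g b = b" "g z = c"
      unfolding generated_eq by blast
    have "T a b c"
      using T_conj[OF g(1) z] g by simp
    thus "\<tau> \<in> generated n k s"
      using abc by (simp add: T_def del: cycle_of_list.simps)
  qed
qed

lemma all_three_cycles_imp_alternating:
  assumes "c_cycles n 3 \<subseteq> generated n k s"
  shows "carrier (alt_group n) \<subseteq> generated n k s"
proof
  fix p assume "p \<in> carrier (alt_group n)"
  hence "p \<in> generate (alt_group n) (c_cycles n 3)"
    by (simp add: alt_group_carrier_as_three_cycles c_cycles_def)
  thus "p \<in> generated n k s"
  proof induction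
    case one
    show ?case
      unfolding alt_group_one generated_eq using expressible_id by blast
  next
    case (incl h)
    thus ?case using assms by blast
  next
    case (inv h)
    have "h \<in> carrier (alt_group n)"
      unfolding alt_group_carrier_as_three_cycles using inv
      by (intro generate.incl) (simp add: c_cycles_def)
    hence "inv\<^bsub>alt_group n\<^esub> h = inv' h"
      by (rule alt_group_inv_equality)
    thus ?case
      using inv assms generated_inv by auto
  next
    case (eng g h)
    thus ?case
      unfolding alt_group_mult using generated_comp by blast
  qed
qed

text \<open>
  A 3-cycle moves one point of a pair and fixes the other. The points are moved one at a time, by
  way of an auxiliary point \<open>y\<close>, so that they never collide.
\<close>

lemma all_three_cycles_imp_two_transitive:
  assumes n: "n \<ge> 5" and "c_cycles n 3 \<subseteq> generated n k s"
  shows two_transitive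
proof -
  have move: "\<exists>g \<in> generated n k s. g p = p \<and> g u = v"
    if "p \<in> {1..n}" "u \<in> {1..n}" "v \<in> {1..n}" "u \<noteq> p" "v \<noteq> p" for p u v
  proof (cases "u = v")
    case True
    have "id \<in> generated n k s"
      unfolding generated_eq using expressible_id by blast
    thus ?thesis
      using True by (intro bexI[of _ id]) auto
  next
    case False
    have "card {p, u, v} < card {1..n}"
      using n by (auto simp: card_insert_if)
    hence "\<not> {1..n} \<subseteq> {p, u, v}"
      using card_mono[of "{p, u, v}" "{1..n}"] by auto
    then obtain x where x: "x \<in> {1..n}" "x \<notin> {p, u, v}"
      by blast
    have d: "distinct [u, v, x]"
      using False x by auto
    have "cycle_of_list [u, v, x] \<in> c_cycles n 3"
      unfolding c_cycles_3 using that x d by blast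
    moreover have "cycle_of_list [u, v, x] p = p" "cycle_of_list [u, v, x] u = v"
      unfolding three_cycle_apply[OF d] using that x by auto
    ultimately show ?thesis
      using assms(2) by blast
  qed
  show ?thesis
    unfolding two_transitive_def
  proof (intro ballI impI)
    fix a b a' b' assume pts: "a \<in> {1..n}" "b \<in> {1..n}" "a' \<in> {1..n}" "b' \<in> {1..n}" "a \<noteq> b" "a' \<noteq> b'"
    have "card {a, b, a', b'} < card {1..n}"
      using n by (auto simp: card_insert_if)
    hence "\<not> {1..n} \<subseteq> {a, b, a', b'}"
      using card_mono[of "{a, b, a', b'}" "{1..n}"] by auto
    then obtain y where y: "y \<in> {1..n}" "y \<notin> {a, b, a', b'}"
      by blast
    obtain g1 where g1: "g1 \<in> generated n k s" "g1 a = a" "g1 b = y"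
      using move[of a b y] pts y by blast
    obtain g2 where g2: "g2 \<in> generated n k s" "g2 y = y" "g2 a = a'"
      using move[of y a a'] pts y by blast
    obtain g3 where g3: "g3 \<in> generated n k s" "g3 a' = a'" "g3 y = b'"
      using move[of a' y b'] pts y by blast
    have "g3 \<circ> (g2 \<circ> g1) \<in> generated n k s"
      by (intro generated_comp g1 g2 g3)
    moreover have "(g3 \<circ> (g2 \<circ> g1)) a = a'" "(g3 \<circ> (g2 \<circ> g1)) b = b'"
      using g1 g2 g3 by auto
    ultimately show "\<exists>g\<in>generated n k s. g a = a' \<and> g b = b'"
      by blast
  qed
qed

text \<open>
  For 3-cycles, a word for pairs carries \<open>\<mu>\<close> to some \<open>(a b z)\<close>. The elements that then move \<open>z\<close> to
  \<open>c\<close> are built from at most four conjugates of \<open>\<mu>\<close>, each of length at most \<open>M + 2 * L\<close>.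
\<close>

lemma cycle_conjugation_distance:
  assumes n: "n \<ge> 9" and c: "c \<in> {2, 3}"
    and pairs: "\<And>a b a' b'. a \<in> {1..n} \<Longrightarrow> b \<in> {1..n} \<Longrightarrow> a \<noteq> b \<Longrightarrow>
      a' \<in> {1..n} \<Longrightarrow> b' \<in> {1..n} \<Longrightarrow> a' \<noteq> b' \<Longrightarrow>
      \<exists>g. expressible k s L g \<and> g a = a' \<and> g b = b'"
    and \<mu>: "\<mu> \<in> c_cycles n c" "expressible k s M \<mu>"
    and \<tau>: "\<tau> \<in> c_cycles n c"
  shows "\<exists>g. expressible k s (4 * (M + 2 * L) + L) g \<and> g \<circ> \<mu> \<circ> inv' g = \<tau>"
proof (cases "c = 2")
  case True
  obtain p q where pq: "\<mu> = cycle_of_list [p, q]" "{p, q} \<subseteq> {1..n}" "p \<noteq> q"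
    using \<mu>(1) unfolding True c_cycles_2 by blast
  obtain a b where ab: "\<tau> = cycle_of_list [a, b]" "{a, b} \<subseteq> {1..n}" "a \<noteq> b"
    using \<tau> unfolding True c_cycles_2 by blast
  obtain g where g: "expressible k s L g" "g p = a" "g q = b"
    using pairs[of p q a b] pq ab by auto
  have "g \<circ> \<mu> \<circ> inv' g = \<tau>"
    unfolding pq ab using conjugation_of_cycle[OF _ permutes_bij[OF expressible_permutes[OF g(1)]], of "[p, q]"] pq g
    by simp
  moreover have "expressible k s (4 * (M + 2 * L) + L) g"
    by (rule expressible_mono[OF g(1)]) simp
  ultimately show ?thesis by blast
next
  case False
  hence c3: "c = 3"
    using c by simp
  obtain p q r where pqr: "\<mu> = cycle_of_list [p, q, r]" "{p, q, r} \<subseteq> {1..n}" "distinct [p, q, r]"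
    using \<mu>(1) unfolding c3 c_cycles_3 by blast
  obtain a b c where abc: "\<tau> = cycle_of_list [a, b, c]" "{a, b, c} \<subseteq> {1..n}" "distinct [a, b, c]"
    using \<tau> unfolding c3 c_cycles_3 by blast
  have move: "\<exists>g z. expressible k s L g \<and> z \<in> {1..n} \<and> distinct [x, y, z] \<and>
      g \<circ> \<mu> \<circ> inv' g = cycle_of_list [x, y, z]"
    if xy: "x \<in> {1..n}" "y \<in> {1..n}" "x \<noteq> y" for x y
  proof -
    obtain g where g: "expressible k s L g" "g p = x" "g q = y"
      using pairs[of p q x y] pqr xy by auto
    note perm = expressible_permutes[OF g(1)]
    have "distinct (map g [p, q, r])"
      using pqr(3) permutes_inj_on[OF perm] by (subst distinct_map) auto
    moreover have "g r \<in> {1..n}"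
      using permutes_in_image[OF perm] pqr(2) by blast
    moreover have "g \<circ> \<mu> \<circ> inv' g = cycle_of_list (map g [p, q, r])"
      unfolding pqr(1) by (rule conjugation_of_cycle[OF pqr(3) permutes_bij[OF perm]])
    ultimately show ?thesis
      using g by (intro exI[of _ g] exI[of _ "g r"]) (simp del: cycle_of_list.simps)
  qed
  obtain g z where g: "expressible k s L g" "z \<in> {1..n}" "distinct [a, b, z]"
      "g \<circ> \<mu> \<circ> inv' g = cycle_of_list [a, b, z]"
    using move[of a b] abc by auto
  have "\<exists>h. expressible k s (4 * (M + 2 * L)) h \<and> h a = a \<and> h b = b \<and> h z = c"
  proof (rule move_point_fixing_two_points[OF n])
    show "\<exists>z\<in>{1..n}. distinct [x, y, z] \<and> expressible k s (M + 2 * L) (cycle_of_list [x, y, z])"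
      if "x \<in> {1..n}" "y \<in> {1..n}" "x \<noteq> y" for x y
      using move[OF that] expressible_conj[OF _ \<mu>(2)] by metis
  qed (use abc g in auto)
  then obtain h where h: "expressible k s (4 * (M + 2 * L)) h" "h a = a" "h b = b" "h z = c"
    by blast
  have bij: "bij g" "bij h"
    using permutes_bij[OF expressible_permutes] g(1) h(1) by auto
  have "h \<circ> g \<circ> \<mu> \<circ> inv' (h \<circ> g) = h \<circ> (g \<circ> \<mu> \<circ> inv' g) \<circ> inv' h"
    by (simp only: o_inv_distrib[OF bij(2,1)] o_assoc)
  also have "\<dots> = cycle_of_list (map h [a, b, z])"
    unfolding g(4) by (rule conjugation_of_cycle[OF g(3) bij(2)])
  also have "\<dots> = \<tau>"
    using h abc by simp
  finally have "h \<circ> g \<circ> \<mu> \<circ> inv' (h \<circ> g) = \<tau>" .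
  moreover have "expressible k s (4 * (M + 2 * L) + L) (h \<circ> g)"
    by (intro expressible_comp h g)
  ultimately show ?thesis by blast
qed

lemma generated_eq_by_parity:
  assumes k: "k \<ge> 2" and n: "n \<ge> 9"
    and transitive: "\<And>a b. a \<in> {1..n} \<Longrightarrow> b \<in> {1..n} \<Longrightarrow> \<exists>g\<in>generated n k s. g a = b"
    and no_partition: "\<not> preserves_uniform_partition n (s 1) (s 2)"
    and \<mu>: "\<mu> \<in> c_cycles n (if \<forall>i\<in>{1..k}. evenperm (s i) then 3 else 2)" "\<mu> \<in> generated n k s"
  shows "c_cycles n 3 \<subseteq> generated n k s"
    and "generated n k s = (if \<forall>i\<in>{1..k}. evenperm (s i) then carrier (alt_group n) else carrier (sym_group n))"
proof -
  have "c_cycles n 3 \<subseteq> generated n k s \<and>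
    generated n k s = (if \<forall>i\<in>{1..k}. evenperm (s i) then carrier (alt_group n) else carrier (sym_group n))"
  proof (cases "\<forall>i\<in>{1..k}. evenperm (s i)")
    case True
    have \<mu>3: "\<mu> \<in> c_cycles n 3"
      using \<mu>(1) unfolding if_P[OF True] .
    have cyc: "c_cycles n 3 \<subseteq> generated n k s"
      by (rule three_cycle_imp_all_three_cycles[OF k n transitive no_partition \<mu>3 \<mu>(2)])
    have "generated n k s \<subseteq> carrier (alt_group n)"
      unfolding generated_def
      by (rule group.generate_subgroup_incl[OF sym_group_is_group _ alt_group_is_subgroup])
        (use True generators_permute in \<open>auto simp: carrier_alt_group\<close>)
    thus ?thesis
      using cyc all_three_cycles_imp_alternating[OF cyc] True by auto
  next
    case False
    have \<mu>2: "\<mu> \<in> c_cycles n 2"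
      using \<mu>(1) unfolding if_not_P[OF False] .
    have sym: "generated n k s = carrier (sym_group n)"
      by (rule transposition_imp_symmetric[OF k transitive no_partition \<mu>2 \<mu>(2)])
    have "c_cycles n 3 \<subseteq> carrier (sym_group n)"
    proof
      fix \<tau> assume "\<tau> \<in> c_cycles n 3"
      then obtain xs where "\<tau> = cycle_of_list xs" "set xs \<subseteq> {1..n}"
        unfolding c_cycles_def by blast
      thus "\<tau> \<in> carrier (sym_group n)"
        using permutes_subset[OF cycle_permutes] by (auto simp: carrier_sym_group)
    qed
    thus ?thesis
      unfolding if_not_P[OF False] sym by simp
  qed
  thus "c_cycles n 3 \<subseteq> generated n k s"
    and "generated n k s = (if \<forall>i\<in>{1..k}. evenperm (s i) then carrier (alt_group n) else carrier (sym_group n))"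
    by blast+
qed

end


section \<open>Breadth-first listings of words\<close>

text \<open>
  If the \<open>j\<close>-th word were longer than \<open>lg\<close>, then all of the \<open>(2 * k)\<^bsup>lg\<^esup> \<ge> n\<^sup>2\<close> words of length \<open>lg\<close>
  would precede it.
\<close>

lemma breadth_first_length_le:
  assumes e: "breadth_first (words k) e" and k: "k \<ge> 2" and lg: "lg \<ge> 1" "n \<le> 2 ^ lg"
    and j: "j < n\<^sup>2"
  shows "length (e j) \<le> lg"
proof (rule ccontr)
  assume contra: "\<not> length (e j) \<le> lg"
  have bij: "bij_betw e UNIV (words k)" and mono: "mono (\<lambda>i. length (e i))"
    using e by (auto simp: breadth_first_def)
  let ?W = "{w. set w \<subseteq> letters k \<and> length w = lg}"
  have "?W \<subseteq> e ` {..<j}"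
  proof
    fix w assume w: "w \<in> ?W"
    hence "w \<in> words k"
      using lg by (auto simp: words_def)
    then obtain i where i: "w = e i"
      using bij by (auto simp: bij_betw_def)
    have "i < j"
    proof (rule ccontr)
      assume "\<not> i < j"
      hence "length (e j) \<le> length (e i)"
        using monoD[OF mono, of j i] by simp
      thus False
        using w i contra by simp
    qed
    thus "w \<in> e ` {..<j}"
      using i by simp
  qed
  hence "card ?W \<le> card (e ` {..<j})"
    by (intro card_mono) auto
  also have "\<dots> \<le> j"
    using card_image_le[of "{..<j}" e] by simp
  finally have "card ?W \<le> j" .
  moreover have "card ?W = (2 * k) ^ lg"
  proof -
    have "finite (letters k)" "card (letters k) = 2 * k"
      by (simp_all add: letters_def card_cartesian_product)
    thus ?thesis
      using card_lists_length_eq[of "letters k" lg] by simp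
  qed
  moreover have "n\<^sup>2 \<le> (2 * k) ^ lg"
  proof -
    have "n\<^sup>2 \<le> (2 ^ lg)\<^sup>2"
      using lg(2) by (rule power_mono) simp
    also have "\<dots> = 4 ^ lg"
      by (simp add: power_mult[symmetric] mult.commute[of lg] power_mult)
    also have "\<dots> \<le> (2 * k) ^ lg"
      using k by (intro power_mono) auto
    finally show ?thesis .
  qed
  ultimately show False
    using j by simp
qed

lemma c_cycle_moves_point:
  assumes "c \<in> {2, 3}" "\<tau> \<in> c_cycles n c"
  shows "\<exists>x. \<tau> x \<noteq> x"
proof (cases "c = 2")
  case True
  obtain a b where ab: "\<tau> = cycle_of_list [a, b]" "a \<noteq> b"
    using assms(2) unfolding True c_cycles_2 by blast
  show ?thesis
    using ab by (intro exI[of _ a]) simp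
next
  case False
  hence c: "c = 3"
    using assms(1) by simp
  obtain a b d where abd: "\<tau> = cycle_of_list [a, b, d]" "distinct [a, b, d]"
    using assms(2) unfolding c c_cycles_3 by blast
  show ?thesis
    unfolding abd(1) three_cycle_apply[OF abd(2)] using abd(2) by (intro exI[of _ a]) simp
qed

lemma id_notin_c_cycles: "c \<in> {2, 3} \<Longrightarrow> id \<notin> c_cycles n c"
  using c_cycle_moves_point[of c id n] by auto

lemma word_perm_replicate: "word_perm s (concat (replicate m w)) = word_perm s w ^^ m"
  by (induction m) (simp_all add: word_perm_append)

lemma set_concat_replicate_subset: "set (concat (replicate m w)) \<subseteq> set w"
  by (auto simp: in_set_replicate)

lemma length_concat_replicate: "length (concat (replicate m w)) = m * length w"
  by (induction m) simp_all

context permutation_generators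
begin

text \<open>
  The conjecture speaks of arbitrary words, the search of reduced ones. Cancelling adjacent inverse
  letters makes a word shorter; it does not become empty because it represents a permutation other
  than the identity.
\<close>

lemma exists_reduced_word:
  assumes "set w \<subseteq> letters k" "word_perm s w \<noteq> id"
  shows "\<exists>v\<in>reduced_words k. length v \<le> length w \<and> word_perm s v = word_perm s w"
  using assms
proof (induction "length w" arbitrary: w rule: less_induct)
  case less
  show ?case
  proof (cases "\<forall>j. Suc j < length w \<longrightarrow> w ! Suc j \<noteq> inv_letter (w ! j)")
    case True
    have "w \<noteq> []"
      using less.prems(2) by auto
    hence "w \<in> reduced_words k"
      using True less.prems(1) by (simp add: reduced_words_def words_def)
    thus ?thesis by blast
  next
    case False
    then obtain j where j: "Suc j < length w" "w ! Suc j = inv_letter (w ! j)"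
      by blast
    let ?u = "take j w" and ?v = "drop (Suc (Suc j)) w"
    have x: "w ! j \<in> letters k"
      using less.prems(1) j(1) by (meson Suc_lessD nth_mem subsetD)
    have w: "w = ?u @ w ! j # inv_letter (w ! j) # ?v"
      using j by (metis Cons_nth_drop_Suc Suc_lessD append_take_drop_id)
    have "letter_perm s (w ! j) \<circ> letter_perm s (inv_letter (w ! j)) = id"
      unfolding letter_perm_inv_letter[OF x] by (rule permutes_inv_o(1)[OF letter_perm_permutes[OF x]])
    hence cancel: "letter_perm s (w ! j) \<circ> (letter_perm s (inv_letter (w ! j)) \<circ> p) = p" for p
      unfolding o_assoc by simp
    have same: "word_perm s w = word_perm s (?u @ ?v)"
      by (subst w) (simp only: word_perm_append word_perm_simps cancel)
    have "length (?u @ ?v) < length w"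
      using j(1) by simp
    moreover have "set (?u @ ?v) \<subseteq> letters k"
      using less.prems(1) set_take_subset[of j w] set_drop_subset[of "Suc (Suc j)" w] by auto
    moreover have "word_perm s (?u @ ?v) \<noteq> id"
      using less.prems(2) same by simp
    ultimately have "\<exists>v\<in>reduced_words k. length v \<le> length (?u @ ?v) \<and> word_perm s v = word_perm s (?u @ ?v)"
      by (rule less.hyps)
    thus ?thesis
      using \<open>length (?u @ ?v) < length w\<close> same by (metis le_trans less_imp_le)
  qed
qed

text \<open>
  The search stops no later than at a reduced form of \<open>w\<close>, hence at a word which is no longer than
  \<open>w\<close>, whatever exponent is then chosen.
\<close>

lemma step1_short:
  assumes e: "breadth_first (reduced_words k) e" and c: "c \<in> {2, 3}"
    and w: "set w \<subseteq> letters k" "m \<le> n" "word_perm s w ^^ m \<in> c_cycles n c"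
  shows "\<exists>v. step1 n c s e = Some v \<and> set v \<subseteq> letters k \<and> length v \<le> n * length w \<and>
    word_perm s v \<in> c_cycles n c"
proof -
  have bij: "bij_betw e UNIV (reduced_words k)" and mono: "mono (\<lambda>i. length (e i))"
    using e by (auto simp: breadth_first_def)
  define good where "good j m \<longleftrightarrow> m \<in> {1..n} \<and> word_perm s (e j) ^^ m \<in> c_cycles n c" for j m
  have m: "m \<noteq> 0"
    using w(3) id_notin_c_cycles[OF c] by (cases m) auto
  have "word_perm s w \<noteq> id"
    using w(3) id_notin_c_cycles[OF c] by (metis id_funpow)
  then obtain v where v: "v \<in> reduced_words k" "length v \<le> length w" "word_perm s v = word_perm s w"
    using exists_reduced_word[OF w(1)] by blast
  then obtain i where i: "v = e i"
    using bij by (auto simp: bij_betw_def)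
  have good_i: "good i m"
    using v i w m by (simp add: good_def)
  define j where "j = (LEAST j. \<exists>m. good j m)"
  define m' where "m' = (SOME m. good j m)"
  have "\<exists>m. good j m"
    unfolding j_def by (rule LeastI[of _ i]) (use good_i in blast)
  hence good_j: "good j m'"
    unfolding m'_def by (rule someI_ex)
  have "j \<le> i"
    unfolding j_def by (rule Least_le) (use good_i in blast)
  hence "length (e j) \<le> length w"
    using monoD[OF mono, of j i] v(2) i by simp
  hence len: "length (concat (replicate m' (e j))) \<le> n * length w"
    unfolding length_concat_replicate using good_j by (intro mult_mono) (auto simp: good_def)
  have "e j \<in> reduced_words k"
    using bij by (auto simp: bij_betw_def)
  hence "set (e j) \<subseteq> letters k"
    by (simp add: reduced_words_def words_def)
  hence set: "set (concat (replicate m' (e j))) \<subseteq> letters k"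
    by (rule order_trans[OF set_concat_replicate_subset])
  have "\<exists>j m. good j m"
    using good_i by blast
  hence "step1 n c s e = Some (concat (replicate m' (e j)))"
    unfolding step1_def Let_def good_def[symmetric] j_def[symmetric] m'_def[symmetric] by (simp only: if_True)
  moreover have "word_perm s (concat (replicate m' (e j))) \<in> c_cycles n c"
    using good_j by (simp add: word_perm_replicate good_def)
  ultimately show ?thesis
    using len set by blast
qed


section \<open>The breadth-first search by conjugation\<close>

abbreviation conj_by :: "letter \<Rightarrow> perm \<Rightarrow> perm" where
  "conj_by x a \<equiv> letter_perm s (inv_letter x) \<circ> a \<circ> letter_perm s x"

text \<open>
  The ball of radius \<open>l\<close> around \<open>\<mu>\<close> in the graph that Step 2 explores.
\<close>

fun conjugates_within :: "perm \<Rightarrow> nat \<Rightarrow> perm set" where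
  "conjugates_within \<mu> 0 = {\<mu>}"
| "conjugates_within \<mu> (Suc l) =
     conjugates_within \<mu> l \<union> {conj_by x a | x a. x \<in> letters k \<and> a \<in> conjugates_within \<mu> l}"

lemma conjugates_within_mono: "l \<le> l' \<Longrightarrow> conjugates_within \<mu> l \<subseteq> conjugates_within \<mu> l'"
  by (rule lift_Suc_mono_le[of "conjugates_within \<mu>"]) auto

lemma word_conj_in_conjugates_within:
  assumes "set w \<subseteq> letters k"
  shows "inv' (word_perm s w) \<circ> \<mu> \<circ> word_perm s w \<in> conjugates_within \<mu> (length w)"
  using assms
proof (induction w rule: rev_induct)
  case Nil
  have "inv' (word_perm s []) \<circ> \<mu> \<circ> word_perm s [] = \<mu>"
    by (simp only: word_perm_simps inv_id id_comp comp_id)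
  thus ?case
    by simp
next
  case (snoc x w)
  let ?g = "word_perm s w"
  have x: "x \<in> letters k" and w: "set w \<subseteq> letters k"
    using snoc.prems by auto
  have wx: "word_perm s (w @ [x]) = ?g \<circ> letter_perm s x"
    by (simp only: word_perm_append word_perm_simps comp_id)
  have inv: "inv' (?g \<circ> letter_perm s x) = letter_perm s (inv_letter x) \<circ> inv' ?g"
    unfolding letter_perm_inv_letter[OF x]
    by (rule o_inv_distrib[OF permutes_bij[OF word_perm_permutes[OF w]] permutes_bij[OF letter_perm_permutes[OF x]]])
  have "inv' (word_perm s (w @ [x])) \<circ> \<mu> \<circ> word_perm s (w @ [x]) = conj_by x (inv' ?g \<circ> \<mu> \<circ> ?g)"
    unfolding wx inv o_assoc ..
  moreover have "conj_by x (inv' ?g \<circ> \<mu> \<circ> ?g) \<in> conjugates_within \<mu> (Suc (length w))"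
    unfolding conjugates_within.simps using snoc.IH[OF w] x by blast
  ultimately show ?case
    by (simp only: length_append_singleton)
qed

lemma expressible_conj_in_conjugates_within:
  assumes "expressible k s d g"
  shows "g \<circ> \<mu> \<circ> inv' g \<in> conjugates_within \<mu> d"
proof -
  obtain w where w: "set w \<subseteq> letters k" "length w \<le> d" "word_perm s w = inv' g"
    using expressible_inv[OF assms] by (auto simp: expressible_def)
  have "inv' (inv' g) = g"
    by (rule inv_inv_eq[OF permutes_bij[OF expressible_permutes[OF assms]]])
  hence "g \<circ> \<mu> \<circ> inv' g \<in> conjugates_within \<mu> (length w)"
    using word_conj_in_conjugates_within[OF w(1), of \<mu>] w(3) by simp
  thus ?thesis
    using conjugates_within_mono[OF w(2)] by blast
qed

text \<open>
  The elements that are already found, or are bound to be found when the queue is worked off.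
\<close>

definition covered :: "(perm \<rightharpoonup> word) \<Rightarrow> (letter \<times> perm) list \<Rightarrow> perm set" where
  "covered T Q = dom T \<union> {conj_by x a | x a. (x, a) \<in> set Q}"

text \<open>
  While level \<open>l\<close> is under construction from a first expression of length \<open>N\<close>, expressions have
  length at most \<open>N + 2 * l\<close>, and those waiting in the queue are shorter by two letters, to leave
  room for the conjugating letters. The last two conditions express completeness. The ball of radius
  \<open>l\<close> is covered, so that it has been found once the queue is empty. All neighbours of elements
  outside the current level \<open>A\<close> are covered too, so that for the next level it suffices to put the
  elements of \<open>A\<close> into the queue.
\<close>

definition search_invariant :: "perm \<Rightarrow> nat \<Rightarrow> nat \<Rightarrow> (perm \<rightharpoonup> word) \<Rightarrow> perm set \<Rightarrow> (letter \<times> perm) list \<Rightarrow> bool" where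
  "search_invariant \<mu> N l T A Q \<longleftrightarrow>
     finite (dom T) \<and> A \<subseteq> dom T \<and>
     (\<forall>a u. T a = Some u \<longrightarrow> set u \<subseteq> letters k \<and> word_perm s u = a \<and> length u \<le> N + 2 * l) \<and>
     (\<forall>x a. (x, a) \<in> set Q \<longrightarrow> x \<in> letters k \<and> a \<in> dom T \<and> length (the (T a)) + 2 \<le> N + 2 * l) \<and>
     conjugates_within \<mu> l \<subseteq> covered T Q \<and>
     (\<forall>x\<in>letters k. \<forall>a\<in>dom T - A. conj_by x a \<in> covered T Q)"

lemma search_invariant_next_level:
  assumes inv: "search_invariant \<mu> N l T A []" and trav: "traversal k trav"
  shows "search_invariant \<mu> N (Suc l) T {} (trav A)"
proof -
  have T: "finite (dom T)" "A \<subseteq> dom T"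
    "\<And>a u. T a = Some u \<Longrightarrow> set u \<subseteq> letters k \<and> word_perm s u = a \<and> length u \<le> N + 2 * l"
    "conjugates_within \<mu> l \<subseteq> dom T"
    "\<And>x a. x \<in> letters k \<Longrightarrow> a \<in> dom T \<Longrightarrow> a \<notin> A \<Longrightarrow> conj_by x a \<in> dom T"
    using inv unfolding search_invariant_def covered_def by auto
  have "finite A"
    using T(1,2) finite_subset by metis
  hence Q: "set (trav A) = letters k \<times> A"
    using trav by (simp add: traversal_def)
  have cov: "conj_by x a \<in> covered T (trav A)" if "x \<in> letters k" "a \<in> dom T" for x a
    using T(5)[OF that] that Q unfolding covered_def by blast
  have "conjugates_within \<mu> (Suc l) \<subseteq> covered T (trav A)"
    unfolding conjugates_within.simps using cov T(4) unfolding covered_def by blast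
  moreover have "length u \<le> N + 2 * Suc l" if "T a = Some u" for a u
    using T(3)[OF that] by simp
  moreover have "x \<in> letters k \<and> a \<in> dom T \<and> length (the (T a)) + 2 \<le> N + 2 * Suc l"
    if "(x, a) \<in> set (trav A)" for x a
  proof -
    have xa: "x \<in> letters k" "a \<in> dom T"
      using that Q T(2) by auto
    then obtain u where "T a = Some u"
      by blast
    thus ?thesis
      using T(3) xa by simp
  qed
  ultimately show ?thesis
    unfolding search_invariant_def using T(1,3) cov by (metis Diff_empty empty_subsetI)
qed

lemma covered_Cons: "covered T ((x, a) # Q) = insert (conj_by x a) (covered T Q)"
proof -
  have "{conj_by y c | y c. (y, c) \<in> set ((x, a) # Q)} =
      insert (conj_by x a) {conj_by y c | y c. (y, c) \<in> set Q}"
    unfolding list.set by blast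
  thus ?thesis
    unfolding covered_def by (simp only: Un_insert_right)
qed

lemma search_invariant_skip:
  assumes inv: "search_invariant \<mu> N l T A ((x, a) # Q)" and "conj_by x a \<in> dom T"
  shows "search_invariant \<mu> N l T A Q"
proof -
  have "covered T ((x, a) # Q) = covered T Q"
    unfolding covered_Cons using assms(2) by (intro insert_absorb) (simp add: covered_def)
  thus ?thesis
    using inv unfolding search_invariant_def by (simp only: list.set insert_iff) blast
qed

lemma search_invariant_insert:
  assumes inv: "search_invariant \<mu> N l T A ((x, a) # Q)" and new: "conj_by x a \<notin> dom T"
  shows "search_invariant \<mu> N l (T(conj_by x a \<mapsto> [inv_letter x] @ the (T a) @ [x]))
    (insert (conj_by x a) A) Q"
proof -
  let ?b = "conj_by x a" and ?v = "[inv_letter x] @ the (T a) @ [x]"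
  let ?T = "T(?b \<mapsto> ?v)"
  have T: "finite (dom T)" "A \<subseteq> dom T"
    "\<And>a u. T a = Some u \<Longrightarrow> set u \<subseteq> letters k \<and> word_perm s u = a \<and> length u \<le> N + 2 * l"
    "\<And>y c. (y, c) \<in> set ((x, a) # Q) \<Longrightarrow> y \<in> letters k \<and> c \<in> dom T \<and> length (the (T c)) + 2 \<le> N + 2 * l"
    "conjugates_within \<mu> l \<subseteq> covered T ((x, a) # Q)"
    "\<And>y c. y \<in> letters k \<Longrightarrow> c \<in> dom T - A \<Longrightarrow> conj_by y c \<in> covered T ((x, a) # Q)"
    using inv unfolding search_invariant_def by blast+
  have dom: "dom ?T = insert ?b (dom T)"
    by simp
  have cov: "covered ?T Q = covered T ((x, a) # Q)"
    unfolding covered_Cons unfolding covered_def dom by (simp only: Un_insert_left)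
  have xa: "x \<in> letters k" "a \<in> dom T" "length (the (T a)) + 2 \<le> N + 2 * l"
    using T(4)[of x a] by auto
  then obtain u where u: "T a = Some u"
    by blast
  have v: "set ?v \<subseteq> letters k" "word_perm s ?v = ?b" "length ?v \<le> N + 2 * l"
  proof -
    show "set ?v \<subseteq> letters k"
      using T(3)[OF u] u xa(1) by (simp del: inv_letter.simps)
    show "word_perm s ?v = ?b"
      using T(3)[OF u] u by (simp only: word_perm_append word_perm_simps comp_id o_assoc option.sel)
    show "length ?v \<le> N + 2 * l"
      using xa(3) by simp
  qed
  have "set u' \<subseteq> letters k \<and> word_perm s u' = a' \<and> length u' \<le> N + 2 * l" if "?T a' = Some u'" for a' u'
  proof (cases "a' = ?b")
    case True
    hence "u' = ?v"
      using that by (simp only: fun_upd_same option.inject)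
    thus ?thesis
      using True v by blast
  next
    case False
    hence "T a' = Some u'"
      using that by (simp only: fun_upd_other not_False_eq_True)
    thus ?thesis
      by (rule T(3))
  qed
  moreover have "y \<in> letters k \<and> c \<in> dom ?T \<and> length (the (?T c)) + 2 \<le> N + 2 * l"
    if "(y, c) \<in> set Q" for y c
  proof -
    have "y \<in> letters k" "c \<in> dom T" "length (the (T c)) + 2 \<le> N + 2 * l"
      using T(4)[of y c] that by auto
    moreover have "c \<noteq> ?b"
      using new calculation(2) by metis
    ultimately show ?thesis
      unfolding dom by (simp only: fun_upd_other insert_iff not_False_eq_True simp_thms)
  qed
  moreover have "conj_by y c \<in> covered ?T Q" if "y \<in> letters k" "c \<in> dom ?T - insert ?b A" for y c
    unfolding cov using T(6) that unfolding dom by blast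
  moreover have "insert ?b A \<subseteq> dom ?T"
    unfolding dom using T(2) by blast
  moreover have "finite (dom ?T)"
    unfolding dom using T(1) by simp
  moreover have "conjugates_within \<mu> l \<subseteq> covered ?T Q"
    unfolding cov by (rule T(5))
  ultimately show ?thesis
    unfolding search_invariant_def by blast
qed

text \<open>
  The search cannot enter a level beyond \<open>d\<close>, because the ball of radius \<open>d\<close> contains \<open>C\<close>. Within a level the
  queue becomes shorter in each step. So the induction is on \<open>d - l\<close> and, inside, on the queue.
\<close>

lemma search_terminates:
  assumes C: "C \<subseteq> conjugates_within \<mu> d" and trav: "traversal k trav"
  shows "search_invariant \<mu> N l T A Q \<Longrightarrow> l \<le> d \<Longrightarrow>
    \<exists>T' A' Q'. while_option (\<lambda>(T, A, Q). \<not> C \<subseteq> dom T) (step2_body s trav) (T, A, Q) = Some (T', A', Q') \<and>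
      C \<subseteq> dom T' \<and> (\<forall>a u. T' a = Some u \<longrightarrow>
        set u \<subseteq> letters k \<and> word_perm s u = a \<and> length u \<le> N + 2 * d)"
proof (induction "d - l" arbitrary: l T A Q rule: less_induct)
  case less
  note next_level = less.hyps
  show ?case
    using less.prems
  proof (induction Q arbitrary: T A)
    case Nil
    show ?case
    proof (cases "C \<subseteq> dom T")
      case True
      have "length u \<le> N + 2 * d" if "length u \<le> N + 2 * l" for u :: word
        using that Nil.prems(2) by simp
      thus ?thesis
        using True Nil.prems(1) by (subst while_option_unfold) (auto simp: search_invariant_def)
    next
      case False
      have "l \<noteq> d"
        using False C Nil.prems(1) unfolding search_invariant_def covered_def by auto
      hence l: "d - Suc l < d - l" "Suc l \<le> d"
        using Nil.prems(2) by auto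
      have unfold: "while_option (\<lambda>(T, A, Q). \<not> C \<subseteq> dom T) (step2_body s trav) (T, A, []) =
          while_option (\<lambda>(T, A, Q). \<not> C \<subseteq> dom T) (step2_body s trav) (T, {}, trav A)"
        using False by (subst while_option_unfold) simp
      show ?thesis
        unfolding unfold by (rule next_level[OF l(1) search_invariant_next_level[OF Nil.prems(1) trav] l(2)])
    qed
  next
    case (Cons xa Q)
    obtain x a where xa: "xa = (x, a)"
      by (cases xa)
    have inv: "search_invariant \<mu> N l T A ((x, a) # Q)"
      using Cons.prems(1) unfolding xa .
    show ?case
    proof (cases "C \<subseteq> dom T")
      case True
      have "length u \<le> N + 2 * d" if "length u \<le> N + 2 * l" for u :: word
        using that Cons.prems(2) by simp
      thus ?thesis
        using True Cons.prems(1) by (subst while_option_unfold) (auto simp: search_invariant_def)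
    next
      case False
      let ?step = "step2_body s trav (T, A, (x, a) # Q)"
      have unfold: "while_option (\<lambda>(T, A, Q). \<not> C \<subseteq> dom T) (step2_body s trav) (T, A, (x, a) # Q) =
          while_option (\<lambda>(T, A, Q). \<not> C \<subseteq> dom T) (step2_body s trav) ?step"
        using False by (subst while_option_unfold) (simp only: prod.case if_True not_False_eq_True)
      show ?thesis
      proof (cases "conj_by x a \<in> dom T")
        case True
        hence step: "?step = (T, A, Q)"
          by (simp only: step2_body.simps Let_def if_True)
        show ?thesis
          unfolding xa unfold step
          by (rule Cons.IH[OF search_invariant_skip[OF inv True] Cons.prems(2)])
      next
        case new: False
        hence step: "?step =
            (T(conj_by x a \<mapsto> [inv_letter x] @ the (T a) @ [x]), insert (conj_by x a) A, Q)"
          by (simp only: step2_body.simps Let_def if_False)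
        show ?thesis
          unfolding xa unfold step
          by (rule Cons.IH[OF search_invariant_insert[OF inv new] Cons.prems(2)])
      qed
    qed
  qed
qed

lemma step2_short:
  assumes w: "set w \<subseteq> letters k" and trav: "traversal k trav"
    and C: "\<And>\<tau>. \<tau> \<in> C \<Longrightarrow> \<exists>g. expressible k s d g \<and> g \<circ> word_perm s w \<circ> inv' g = \<tau>"
  shows "\<exists>T. step2 s trav C w = Some T \<and> C \<subseteq> dom T \<and> (\<forall>a u. T a = Some u \<longrightarrow>
    set u \<subseteq> letters k \<and> word_perm s u = a \<and> length u \<le> length w + 2 * d)"
proof -
  let ?\<mu> = "word_perm s w"
  have "C \<subseteq> conjugates_within ?\<mu> d"
    using C expressible_conj_in_conjugates_within by blast
  moreover have "search_invariant ?\<mu> (length w) 0 [?\<mu> \<mapsto> w] {?\<mu>} []"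
    using w unfolding search_invariant_def covered_def by auto
  ultimately show ?thesis
    using search_terminates[OF _ trav, of C ?\<mu> d "length w" 0 "[?\<mu> \<mapsto> w]" "{?\<mu>}" "[]"]
    unfolding step2_def Let_def by fastforce
qed

text \<open>
  The final step of the algorithm.
\<close>

lemma substitute_short:
  assumes T: "\<And>a u. T a = Some u \<Longrightarrow> set u \<subseteq> letters k \<and> word_perm s u = a \<and> length u \<le> N"
    and "set cs \<subseteq> dom T"
  defines "w \<equiv> concat (map (\<lambda>a. the (T a)) cs)"
  shows "set w \<subseteq> letters k \<and> word_perm s w = foldr (\<circ>) cs id \<and> length w \<le> length cs * N"
  unfolding w_def using assms(2)
proof (induction cs)
  case (Cons a cs)
  then obtain u where u: "T a = Some u"
    by auto
  have IH: "set (concat (map (\<lambda>a. the (T a)) cs)) \<subseteq> letters k"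
    "word_perm s (concat (map (\<lambda>a. the (T a)) cs)) = foldr (\<circ>) cs id"
    "length (concat (map (\<lambda>a. the (T a)) cs)) \<le> length cs * N"
    using Cons.IH Cons.prems by (simp_all only: list.set insert_subset)
  have "word_perm s (concat (map (\<lambda>a. the (T a)) (a # cs))) = foldr (\<circ>) (a # cs) id"
    using T[OF u] u IH(2)
    by (simp only: list.map concat.simps word_perm_append foldr_Cons o_apply option.sel)
  moreover have "set (concat (map (\<lambda>a. the (T a)) (a # cs))) \<subseteq> letters k"
    using T[OF u] u IH(1) by simp
  moreover have "length (concat (map (\<lambda>a. the (T a)) (a # cs))) \<le> length (a # cs) * N"
    using T[OF u] u IH(3) by simp
  ultimately show ?case
    by blast
qed simp

lemma membership_search_short:
  assumes c: "cycle_length n k s = c" "c \<in> {2, 3}"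
    and w: "set w \<subseteq> letters k" "length w \<le> lg" "m \<le> n" "word_perm s w ^^ m \<in> c_cycles n c"
    and distance: "\<And>\<mu> \<tau>. \<mu> \<in> c_cycles n c \<Longrightarrow> expressible k s (n * lg) \<mu> \<Longrightarrow> \<tau> \<in> c_cycles n c \<Longrightarrow>
      \<exists>g. expressible k s d g \<and> g \<circ> \<mu> \<circ> inv' g = \<tau>"
    and e: "breadth_first (reduced_words k) e" and trav: "traversal k trav"
    and cs: "canonical_expression n c \<sigma> cs"
  shows "\<exists>v. membership_search n k s e trav cs = Some v \<and> set v \<subseteq> letters k \<and>
    word_perm s v = \<sigma> \<and> length v \<le> n * (n * lg + 2 * d)"
proof -
  obtain u where u: "step1 n c s e = Some u" "set u \<subseteq> letters k" "length u \<le> n * length w"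
      "word_perm s u \<in> c_cycles n c"
    using step1_short[OF e c(2) w(1,3,4)] by blast
  have len_u: "length u \<le> n * lg"
    by (rule order_trans[OF u(3) mult_le_mono2[OF w(2)]])
  have "expressible k s (n * lg) (word_perm s u)"
    unfolding expressible_def using u(2) len_u by blast
  hence "\<exists>g. expressible k s d g \<and> g \<circ> word_perm s u \<circ> inv' g = \<tau>" if "\<tau> \<in> set cs" for \<tau>
    using distance[OF u(4)] that cs unfolding canonical_expression_def by blast
  then obtain T where T: "step2 s trav (set cs) u = Some T" "set cs \<subseteq> dom T"
      "\<And>a v. T a = Some v \<Longrightarrow> set v \<subseteq> letters k \<and> word_perm s v = a \<and> length v \<le> length u + 2 * d"
    using step2_short[OF u(2) trav, of "set cs" d] by blast
  let ?v = "concat (map (\<lambda>a. the (T a)) cs)"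
  have v: "set ?v \<subseteq> letters k" "word_perm s ?v = foldr (\<circ>) cs id" "length ?v \<le> length cs * (length u + 2 * d)"
    using substitute_short[OF T(3,2)] by blast+
  have "real (length cs) \<le> real n / (real c - 1)"
    using cs by (simp add: canonical_expression_def)
  also have "\<dots> \<le> real n / 1"
    using c(2) by (intro divide_left_mono) auto
  finally have "length cs \<le> n"
    by simp
  hence "length cs * (length u + 2 * d) \<le> n * (n * lg + 2 * d)"
    using len_u by (intro mult_le_mono add_le_mono) auto
  hence "length ?v \<le> n * (n * lg + 2 * d)"
    using v(3) by linarith
  moreover have "membership_search n k s e trav cs = Some ?v"
    unfolding membership_search_def c(1) using u(1) T(1) by simp
  moreover have "word_perm s ?v = \<sigma>"
    using v(2) cs by (simp add: canonical_expression_def)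
  ultimately show ?thesis
    using v(1) by blast
qed

end


section \<open>The length bound for random generators\<close>

lemma alt_group_neq_sym_group:
  assumes "n \<ge> 2"
  shows "carrier (alt_group n) \<noteq> carrier (sym_group n)"
proof
  assume "carrier (alt_group n) = carrier (sym_group n)"
  hence "2 * (fact n :: nat) = fact n"
    using alt_group_card_carrier[OF assms] sym_group_card_carrier[of n] by metis
  thus False
    by simp
qed

context permutation_generators
begin

text \<open>
  Collects the bounds: with \<open>lg\<close> for the binary logarithm of \<open>n\<close>, points are at distance
  \<open>O(lg)\<close>, pairs at distance \<open>O(n * lg)\<close>, and so are \<open>c\<close>-cycles.
\<close>

lemma search_short_if_expanding:
  assumes k: "k \<ge> 2" and n: "n \<ge> 9" and lg: "lg \<ge> 1" "n \<le> 2 ^ lg"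
    and expanding: "expanding n (s 1) (s 2)"
    and no_partition: "\<not> preserves_uniform_partition n (s 1) (s 2)"
    and w: "set w \<subseteq> letters k" "length w \<le> lg" "m \<le> n"
      "word_perm s w ^^ m \<in> c_cycles n (if \<forall>i\<in>{1..k}. evenperm (s i) then 3 else 2)"
  shows "generated n k s \<in> {carrier (sym_group n), carrier (alt_group n)}"
    and "breadth_first (reduced_words k) e \<Longrightarrow> traversal k trav \<Longrightarrow>
      canonical_expression n (cycle_length n k s) \<sigma> cs \<Longrightarrow>
      \<exists>v. membership_search n k s e trav cs = Some v \<and> set v \<subseteq> letters k \<and>
        word_perm s v = \<sigma> \<and> length v \<le> 7000 * n\<^sup>2 * lg"
proof -
  define c :: nat where "c = (if \<forall>i\<in>{1..k}. evenperm (s i) then 3 else 2)"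
  define L1 where "L1 = 128 * lg"
  define L2 where "L2 = L1 + n * (2 * L1 + 1)"
  define d where "d = 4 * (n * lg + 2 * L2) + L2"
  have c: "c \<in> {2, 3}"
    by (simp add: c_def)
  have cyc: "word_perm s w ^^ m \<in> c_cycles n c"
    using w(4) unfolding c_def .
  have points: "\<exists>g. expressible k s L1 g \<and> g a = b" if "a \<in> {1..n}" "b \<in> {1..n}" for a b
    unfolding L1_def by (rule point_distance[OF k expanding lg(2) that])
  have transitive: "\<exists>g\<in>generated n k s. g a = b" if "a \<in> {1..n}" "b \<in> {1..n}" for a b
    using points[OF that] unfolding generated_eq by blast
  have set_power: "set (concat (replicate m w)) \<subseteq> letters k"
    by (rule order_trans[OF set_concat_replicate_subset w(1)])
  have in_gen: "word_perm s w ^^ m \<in> generated n k s"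
    unfolding generated_eq expressible_def word_perm_replicate[symmetric] using set_power by blast
  note group = generated_eq_by_parity[OF k n transitive no_partition w(4) in_gen]
  have gen_eq: "generated n k s =
      (if \<forall>i\<in>{1..k}. evenperm (s i) then carrier (alt_group n) else carrier (sym_group n))"
    by (rule group(2))
  show "generated n k s \<in> {carrier (sym_group n), carrier (alt_group n)}"
    by (simp add: gen_eq)
  have len: "cycle_length n k s = c"
    unfolding cycle_length_def gen_eq c_def using alt_group_neq_sym_group[of n] n by simp
  have two_transitive
    using n by (intro all_three_cycles_imp_two_transitive group(1)) simp
  note pairs = pair_distance[OF this points, folded L2_def]
  have distance: "\<exists>g. expressible k s d g \<and> g \<circ> \<mu> \<circ> inv' g = \<tau>"
    if "\<mu> \<in> c_cycles n c" "expressible k s (n * lg) \<mu>" "\<tau> \<in> c_cycles n c" for \<mu> \<tau>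
    unfolding d_def by (rule cycle_conjugation_distance[OF n c pairs that])
  have "n * (n * lg + 2 * d) \<le> n * (7000 * (n * lg))"
  proof (rule mult_le_mono2)
    define x where "x = n * lg"
    have "lg \<le> x" "n \<le> x"
      using n lg by (auto simp: x_def)
    moreover have "L2 = 128 * lg + 256 * x + n"
      by (simp add: L2_def L1_def x_def algebra_simps)
    moreover have "d = 4 * x + 9 * L2"
      by (simp add: d_def x_def)
    ultimately show "n * lg + 2 * d \<le> 7000 * (n * lg)"
      unfolding x_def[symmetric] by linarith
  qed
  hence bound: "n * (n * lg + 2 * d) \<le> 7000 * n\<^sup>2 * lg"
    by (simp add: power2_eq_square algebra_simps)
  show "\<exists>v. membership_search n k s e trav cs = Some v \<and> set v \<subseteq> letters k \<and>
        word_perm s v = \<sigma> \<and> length v \<le> 7000 * n\<^sup>2 * lg"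
    if "breadth_first (reduced_words k) e" "traversal k trav"
      "canonical_expression n (cycle_length n k s) \<sigma> cs"
  proof -
    have "\<exists>v. membership_search n k s e trav cs = Some v \<and> set v \<subseteq> letters k \<and>
        word_perm s v = \<sigma> \<and> length v \<le> n * (n * lg + 2 * d)"
      by (rule membership_search_short[OF len c w(1-3) cyc _ that(1,2) that(3)[unfolded len]])
        (rule distance)
    thus ?thesis
      using bound order_trans by blast
  qed
qed

end

lemma nat_ceiling_log_bounds:
  fixes n :: nat
  assumes "n \<ge> 2"
  defines "lg \<equiv> nat \<lceil>log 2 n\<rceil>"
  shows "lg \<ge> 1" "n \<le> 2 ^ lg" "real lg \<le> 3 * ln n"
proof -
  have log: "log 2 n \<ge> 1"
    using assms(1) by simp
  have ceil: "real lg = of_int \<lceil>log 2 n\<rceil>"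
    unfolding lg_def using log by simp
  have ge: "log 2 n \<le> real lg"
    unfolding ceil by linarith
  show "lg \<ge> 1"
    using ge log by linarith
  have "real n = 2 powr log 2 n"
    using assms(1) by simp
  also have "\<dots> \<le> 2 powr real lg"
    using ge by (intro powr_mono) auto
  also have "\<dots> = 2 ^ lg"
    by (simp add: powr_realpow)
  finally show "n \<le> 2 ^ lg"
    by (metis of_nat_le_iff of_nat_numeral of_nat_power)
  have "real lg \<le> log 2 n + 1"
    unfolding ceil by linarith
  also have "\<dots> \<le> 2 * log 2 n"
    using log by simp
  also have "\<dots> = 2 * ln n / ln 2"
    by (simp add: log_def)
  also have "\<dots> \<le> 2 * ln n / (2 / 3)"
    using ln2_ge_two_thirds assms(1) by (intro divide_left_mono) auto
  finally show "real lg \<le> 3 * ln n"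
    by simp
qed

text \<open>
  From \<open>(n / m)\<^sup>m \<le> n choose m\<close> for \<open>m = 2\<close> and \<open>m = 3\<close>, the bound is \<open>4 / n + 27 / n\<close>.
\<close>

lemma prob_partition_le:
  assumes "k \<ge> 2" "n \<ge> 3"
  shows "measure_pmf.prob (random_generators k n) {s. preserves_uniform_partition n (s 1) (s 2)} \<le> 31 / n"
proof -
  have "(real n / real 2) ^ 2 \<le> real (n choose 2)" "(real n / real 3) ^ 3 \<le> real (n choose 3)"
    using assms(2) by (intro binomial_ge_n_over_k_pow_k; simp)+
  hence "real n / real (n choose 2) \<le> real n / (real n / real 2) ^ 2"
    "real n / real (n choose 3) \<le> real n / (real n / real 3) ^ 3"
    using assms(2) by (intro divide_left_mono mult_pos_pos; simp)+
  hence "real n / real (n choose 2) + real n * (real n / real (n choose 3)) \<le>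
      real n / (real n / real 2) ^ 2 + real n * (real n / (real n / real 3) ^ 3)"
    by (intro add_mono mult_left_mono) auto
  also have "\<dots> = 31 / n"
    using assms(2) by (simp add: power2_eq_square power3_eq_cube field_simps)
  finally show ?thesis
    using prob_preserves_uniform_partition[OF assms] by linarith
qed

text \<open>
  Only the event \<open>C\<close> need be almost certain without a rate; this is all that the conjecture provides.
\<close>

lemma almost_alwaysI:
  assumes C: "almost_always k C" and n0: "n0 \<ge> (1 :: nat)"
    and bad: "\<And>n. n \<ge> n0 \<Longrightarrow> measure_pmf.prob (random_generators k n) {s. B n s} \<le> b / n"
    and imp: "\<And>n s. n \<ge> n0 \<Longrightarrow> s \<in> set_pmf (random_generators k n) \<Longrightarrow> C n s \<Longrightarrow> \<not> B n s \<Longrightarrow> P n s"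
  shows "almost_always k P"
  unfolding almost_always_def
proof (rule tendsto_sandwich)
  let ?P = "\<lambda>n. measure_pmf.prob (random_generators k n)"
  have "?P n {s. C n s} \<le> ?P n {s. P n s} + b / n" if n: "n \<ge> n0" for n
  proof -
    have "?P n {s. C n s} \<le> ?P n ({s. P n s} \<union> {s. B n s})"
      using imp[OF n] by (intro measure_pmf.finite_measure_mono_AE) (auto simp: AE_measure_pmf_iff)
    also have "\<dots> \<le> ?P n {s. P n s} + ?P n {s. B n s}"
      by (intro measure_Un_le) auto
    finally show ?thesis
      using bad[OF n] by linarith
  qed
  thus "\<forall>\<^sub>F n in sequentially. ?P n {s. C n s} - b / n \<le> ?P n {s. P n s}"
    by (intro eventually_sequentiallyI[of n0]) (simp add: diff_le_eq)
  show "\<forall>\<^sub>F n in sequentially. ?P n {s. P n s} \<le> 1"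
    by simp
  have "(\<lambda>n. ?P n {s. C n s} - b / n) \<longlonglongrightarrow> 1 - 0"
    using C unfolding almost_always_def by (intro tendsto_diff lim_const_over_n)
  thus "(\<lambda>n. ?P n {s. C n s} - b / n) \<longlonglongrightarrow> 1"
    by simp
qed simp

theorem corollary19:
  fixes k :: nat and listing :: "nat \<Rightarrow> word"
  assumes "k \<ge> 2"
    and "breadth_first (words k) listing"
    and "minimal_cycle_conjecture k listing"
  shows "\<exists>K::real. almost_always k (\<lambda>n s.
           generated n k s \<in> {carrier (sym_group n), carrier (alt_group n)} \<and>
           (\<forall>\<sigma> \<in> generated n k s. \<forall>e trav cs.
              breadth_first (reduced_words k) e \<and> traversal k trav \<and>
              canonical_expression n (cycle_length n k s) \<sigma> cs \<longrightarrow>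
              (\<exists>w. membership_search n k s e trav cs = Some w \<and>
                   set w \<subseteq> letters k \<and> word_perm s w = \<sigma> \<and>
                   real (length w) \<le> K * (real n)\<^sup>2 * ln (real n))))"
proof (intro exI[of _ 21000], rule almost_alwaysI)
  let ?P = "\<lambda>n. measure_pmf.prob (random_generators k n)"
  let ?B = "\<lambda>n s. \<not> expanding n (s 1) (s 2) \<or> preserves_uniform_partition n (s 1) (s 2)"
  show "almost_always k (\<lambda>n s. let c = (if \<forall>i\<in>{1..k}. evenperm (s i) then 3 else 2)
       in \<exists>j < n\<^sup>2. \<exists>m \<le> n. word_perm s (listing j) ^^ m \<in> c_cycles n c)"
    using assms(3) unfolding minimal_cycle_conjecture_def .
  show "?P n {s. ?B n s} \<le> 55 / n" if n: "n \<ge> 9" for n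
  proof -
    have "?P n {s. ?B n s} \<le> ?P n {s. \<not> expanding n (s 1) (s 2)} +
        ?P n {s. preserves_uniform_partition n (s 1) (s 2)}"
      unfolding Collect_disj_eq by (intro measure_Un_le) auto
    also have "\<dots> \<le> 24 / n + 31 / n"
      using n assms(1) by (intro add_mono prob_not_expanding prob_partition_le) auto
    finally show ?thesis
      by (simp add: add_divide_distrib[symmetric])
  qed
  fix n and s :: "nat \<Rightarrow> perm"
  assume n: "9 \<le> n" and s: "s \<in> set_pmf (random_generators k n)" and nB: "\<not> ?B n s"
    and "let c = (if \<forall>i\<in>{1..k}. evenperm (s i) then 3 else 2)
       in \<exists>j < n\<^sup>2. \<exists>m \<le> n. word_perm s (listing j) ^^ m \<in> c_cycles n c"
  then obtain j m where jm: "j < n\<^sup>2" "m \<le> n" "word_perm s (listing j) ^^ m \<in>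
      c_cycles n (if \<forall>i\<in>{1..k}. evenperm (s i) then 3 else 2)"
    unfolding Let_def by blast
  interpret permutation_generators n k s
    by unfold_locales (rule random_generators_permute[OF s])
  define lg where "lg = nat \<lceil>log 2 n\<rceil>"
  have "n \<ge> 2"
    using n by simp
  note lg = nat_ceiling_log_bounds[OF this, folded lg_def]
  have "listing j \<in> words k"
    using assms(2) bij_betwE[of listing UNIV "words k"] unfolding breadth_first_def by blast
  hence w: "set (listing j) \<subseteq> letters k"
    by (simp add: words_def)
  have good: "expanding n (s 1) (s 2)" "\<not> preserves_uniform_partition n (s 1) (s 2)"
    using nB by blast+
  note short = search_short_if_expanding[OF assms(1) n lg(1,2) good w
      breadth_first_length_le[OF assms(2,1) lg(1,2) jm(1)] jm(2,3)]
  have real_bound: "real l \<le> 21000 * (real n)\<^sup>2 * ln (real n)" if "l \<le> 7000 * n\<^sup>2 * lg" for l :: nat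
  proof -
    have "real l \<le> real (7000 * n\<^sup>2 * lg)"
      using that by (rule of_nat_mono)
    also have "\<dots> = 7000 * (real n)\<^sup>2 * real lg"
      by simp
    also have "\<dots> \<le> 7000 * (real n)\<^sup>2 * (3 * ln n)"
      using lg(3) by (intro mult_left_mono) auto
    finally show ?thesis
      by simp
  qed
  show "generated n k s \<in> {carrier (sym_group n), carrier (alt_group n)} \<and>
           (\<forall>\<sigma> \<in> generated n k s. \<forall>e trav cs.
              breadth_first (reduced_words k) e \<and> traversal k trav \<and>
              canonical_expression n (cycle_length n k s) \<sigma> cs \<longrightarrow>
              (\<exists>w. membership_search n k s e trav cs = Some w \<and>
                   set w \<subseteq> letters k \<and> word_perm s w = \<sigma> \<and>
                   real (length w) \<le> 21000 * (real n)\<^sup>2 * ln (real n)))"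
  proof (intro conjI ballI allI impI)
    show "generated n k s \<in> {carrier (sym_group n), carrier (alt_group n)}"
      by (rule short(1))
    fix \<sigma> e trav cs
    assume "breadth_first (reduced_words k) e \<and> traversal k trav \<and>
      canonical_expression n (cycle_length n k s) \<sigma> cs"
    then obtain v where v: "membership_search n k s e trav cs = Some v" "set v \<subseteq> letters k"
        "word_perm s v = \<sigma>" "length v \<le> 7000 * n\<^sup>2 * lg"
      using short(2)[of e trav \<sigma> cs] by blast
    show "\<exists>w. membership_search n k s e trav cs = Some w \<and> set w \<subseteq> letters k \<and>
        word_perm s w = \<sigma> \<and> real (length w) \<le> 21000 * (real n)\<^sup>2 * ln (real n)"
      using v(1-3) real_bound[OF v(4)] by (intro exI[of _ v] conjI)
  qed
qed simp

end
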